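(* Let $G$ be a finite group, $K\le G$, $(\theta,V)$ an irreducible $K$-representation of dimension $d_\theta$, $v\in V$ with $\|v\|=1$, and $\{v_1,\dots,v_{d_\theta}\}$ an orthonormal basis of $V$ with $v_1=v$. With the notation of the context: (1) The operator $T_v$ belongs to $\mathrm{Hom}_G(\mathrm{Ind}_K^GV,L(G))$ and is an isometry; in particular $\mathcal I(G,K,\psi)$ is a $\lambda_G$-invariant subspace of $L(G)$ which is $G$-isomorphic to $\mathrm{Ind}_K^GV$. (2) $\psi*\psi=\psi$ and $\psi^*=\psi$; moreover $P:L(G)\to L(G)$, $Pf=f*\psi$, is the orthogonal projection of $L(G)$ onto $\mathcal I(G,K,\psi)$; in other words $\mathcal I(G,K,\psi)=\{f*\psi: f\in L(G)\}=\{f\in L(G): f*\psi=f\}$. (3) Let $\mathcal H(G,K,\psi)=\{\psi*f*\psi: f\in L(G)\}=\{f\in L(G): f=\psi*f*\psi\}$. Then $\mathcal H(G,K,\psi)$ is an involutive subalgebra of $L(G)$ contained in $\mathcal I(G,K,\psi)$, and $S_v$ yields a $*$-antiisomorphism from $\widetilde{\mathcal H}(G,K,\theta)$ onto $\mathcal H(G,K,\psi)$. Every $f\in\mathcal H(G,K,\psi)$ is supported in $\bigsqcup_{s\in\mathcal S_0}KsK$. Moreover $\frac{1}{\sqrt{d_\theta}}S_v$ is an isometry, and $$T_v[\xi(F)f]=(T_vf)*(S_vF)$$ for all $f\in\mathrm{Ind}_K^GV$ and $F\in\widetilde{\mathcal H}(G,K,\theta)$. The inverse $S_v^{-1}$ is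 given by $$\langle [S_v^{-1}f](g)v_i,v_j\rangle=\frac{d_\theta}{|K|^2}\sum_{k_1,k_2\in K}f(k_1^{-1}gk_2)\,\overline{\langle\theta(k_1)v_1,v_i\rangle}\,\langle\theta(k_2)v_1,v_j\rangle$$ for all $f\in\mathcal H(G,K,\psi)$, $g\in G$, $i,j=1,\dots,d_\theta$. (4) The map $\mathcal H(G,K,\psi)\to\mathrm{End}_G(\mathcal I(G,K,\psi))$, $f\mapsto T_f|_{\mathcal I(G,K,\psi)}$, where $T_ff'=f'*f$, is a $*$-antiisomorphism of algebras, and $\ker T_f$ contains $\mathcal I(G,K,\psi)^\perp$ for all $f\in\mathcal H(G,K,\psi)$. Moreover $$T_f|_{\mathcal I(G,K,\psi)}=T_v\circ\xi(S_v^{-1}f)\circ T_v^{-1}$$ and $$\langle T_{f_1},T_{f_2}\rangle_{\mathrm{End}_G(\mathcal I(G,K,\psi))}=\frac{|G|}{\dim\mathcal I(G,K,\psi)}\langle f_1,f_2\rangle_{L(G)}$$ for all $f,f_1,f_2\in\mathcal H(G,K,\psi)$.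
   Context: Representations are unitary on finite-dimensional complex inner product spaces; inner products are conjugate-linear in the second argument. For such a $W$, $\mathrm{End}(W)$ has scalar product $\langle T_1,T_2\rangle=\frac1{\dim W}\mathrm{tr}(T_2^*T_1)$, restricted to $\mathrm{End}_G(W)$. $L(G)$ is the space of functions $G\to\mathbb C$ with $[f_1*f_2](g)=\sum_{h\in G}f_1(gh)f_2(h^{-1})$, $f^*(g)=\overline{f(g^{-1})}$, $\langle f_1,f_2\rangle_{L(G)}=\sum_gf_1(g)\overline{f_2(g)}$, and $[\lambda_G(h)f](g)=f(h^{-1}g)$. $L(K)$ is identified with the functions in $L(G)$ supported on $K$. $\mathrm{Ind}_K^GV=\{f:G\to V: f(gk)=\theta(k^{-1})f(g)\}$ with $[\lambda(g)f](g')=f(g^{-1}g')$ and $\langle f_1,f_2\rangle=\frac1{|K|}\sum_g\langle f_1(g),f_2(g)\rangle_V$. $\widetilde{\mathcal H}(G,K,\theta)$ is the $*$-algebra of all $F:G\to\mathrm{End}(V)$ with $F(k_1gk_2)=\theta(k_2^{-1})F(g)\theta(k_1^{-1})$, product $[F_1*F_2](g)=\sum_hF_1(h^{-1}g)F_2(h)$, involution $F^*(g)=[F(g^{-1})]^*$, and scalar product $\sum_g\langle F_1(g),F_2(g)\rangle_{\mathrm{End}(V)}$. The map $\xi:\widetilde{\mathcal H}(G,K,\theta)\to\mathrm{End}_G(\mathrm{Ind}_K^GV)$ is $[\xi(F)f](g)=\sum_{h\in G}F(h^{-1}g)f(h)$. $\psi\in L(K)\subseteq L(G)$ is $\psi(k)=\frac{d_\theta}{|K|}\langle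 v,\theta(k)v\rangle$ for $k\in K$ (and $0$ off $K$). $T_v:\mathrm{Ind}_K^GV\to L(G)$ is $[T_vf](g)=\sqrt{d_\theta/|K|}\,\langle f(g),v\rangle_V$; $\mathcal I(G,K,\psi)=T_v(\mathrm{Ind}_K^GV)$ denotes its range (and $T_v^{-1}$ is the inverse of $T_v$ onto its range). $S_v:\widetilde{\mathcal H}(G,K,\theta)\to L(G)$ is $[S_vF](g)=d_\theta\langle F(g)v,v\rangle_V$. $\mathcal S\ni 1_G$ is a complete set of representatives of the double cosets $KsK$ in $G$; for $s\in\mathcal S$, $K_s=K\cap sKs^{-1}$, and $\theta^s$ is the $K_s$-representation on $V$ given by $\theta^s(x)=\theta(s^{-1}xs)$; $\mathcal S_0=\{s\in\mathcal S:\mathrm{Hom}_{K_s}(\mathrm{Res}^K_{K_s}\theta,\theta^s)\neq 0\}$. *)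

theory Defs
  imports
    Complex_Main
    "HOL-Algebra.Coset"
    "HOL-Library.Function_Algebras"
begin

text \<open>
  Conventions.  Vector spaces are types equipped with an explicit scalar multiplication
  (the library locale \<^locale>\<open>vector_space\<close>), or linear subspaces \<open>W\<close> of such types.
  A function on the group \<open>G\<close> is represented by a function on the underlying type that vanishes
  off \<^term>\<open>carrier G\<close>; likewise a map with domain \<open>W\<close> is represented by a function that vanishes
  off \<open>W\<close>.  With this choice addition and scalar multiplication of functions and of operators
  are pointwise, and multiplication of operators is \<^term>\<open>(\<circ>)\<close>.
\<close>

section \<open>Complex inner product spaces and operators\<close>

text \<open>\<open>ip\<close> is linear in the first and conjugate-linear in the second argument.\<close>

locale fd_inner_product_space = vector_space scale
  for scale :: "complex \<Rightarrow> 'v::ab_group_add \<Rightarrow> 'v" +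
  fixes ip :: "'v \<Rightarrow> 'v \<Rightarrow> complex"
  assumes ip_add_left: "ip (x + y) z = ip x z + ip y z"
    and ip_scale_left: "ip (scale c x) y = c * ip x y"
    and ip_commute: "ip y x = cnj (ip x y)"
    and ip_pos: "x \<noteq> 0 \<Longrightarrow> Re (ip x x) > 0"
    and finite_dim: "\<exists>B. finite B \<and> span B = UNIV"

definition ip_norm :: "('v \<Rightarrow> 'v \<Rightarrow> complex) \<Rightarrow> 'v \<Rightarrow> real" where
  "ip_norm ip x = sqrt (Re (ip x x))"

definition fun_scale :: "(complex \<Rightarrow> 'b \<Rightarrow> 'b) \<Rightarrow> complex \<Rightarrow> ('a \<Rightarrow> 'b) \<Rightarrow> 'a \<Rightarrow> 'b" where
  "fun_scale scale c f = (\<lambda>x. scale c (f x))"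

definition on_dom :: "'a set \<Rightarrow> ('a \<Rightarrow> 'b::zero) \<Rightarrow> 'a \<Rightarrow> 'b" where
  "on_dom W T = (\<lambda>x. if x \<in> W then T x else 0)"

definition lin_maps ::
  "(complex \<Rightarrow> 'a::ab_group_add \<Rightarrow> 'a) \<Rightarrow> 'a set \<Rightarrow> (complex \<Rightarrow> 'b::ab_group_add \<Rightarrow> 'b) \<Rightarrow> 'b set
    \<Rightarrow> ('a \<Rightarrow> 'b) set" where
  "lin_maps scale1 W1 scale2 W2 =
    {T. (\<forall>x\<in>W1. T x \<in> W2) \<and>
        (\<forall>x\<in>W1. \<forall>y\<in>W1. T (x + y) = T x + T y) \<and>
        (\<forall>c. \<forall>x\<in>W1. T (scale1 c x) = scale2 c (T x)) \<and>
        (\<forall>x. x \<notin> W1 \<longrightarrow> T x = 0)}"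

definition isometric_on ::
  "'a set \<Rightarrow> ('a \<Rightarrow> 'a \<Rightarrow> complex) \<Rightarrow> ('b \<Rightarrow> 'b \<Rightarrow> complex) \<Rightarrow> ('a \<Rightarrow> 'b) \<Rightarrow> bool" where
  "isometric_on W ip1 ip2 T \<longleftrightarrow> (\<forall>x\<in>W. \<forall>y\<in>W. ip2 (T x) (T y) = ip1 x y)"

definition adjoint_on ::
  "(complex \<Rightarrow> 'a::ab_group_add \<Rightarrow> 'a) \<Rightarrow> ('a \<Rightarrow> 'a \<Rightarrow> complex) \<Rightarrow> 'a set \<Rightarrow> ('a \<Rightarrow> 'a) \<Rightarrow> 'a \<Rightarrow> 'a" where
  "adjoint_on scale ip W T =
    (THE T'. T' \<in> lin_maps scale W scale W \<and> (\<forall>x\<in>W. \<forall>y\<in>W. ip (T x) y = ip x (T' y)))"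

text \<open>Sum of the diagonal entries of the matrix of \<open>T\<close> in some basis of \<open>W\<close>.\<close>

definition trace_on ::
  "(complex \<Rightarrow> 'a::ab_group_add \<Rightarrow> 'a) \<Rightarrow> 'a set \<Rightarrow> ('a \<Rightarrow> 'a) \<Rightarrow> complex" where
  "trace_on scale W T =
    (let B = (SOME B. \<not> module.dependent scale B \<and> module.span scale B = W)
     in \<Sum>b\<in>B. module.representation scale B (T b) b)"

definition End_ip ::
  "(complex \<Rightarrow> 'a::ab_group_add \<Rightarrow> 'a) \<Rightarrow> ('a \<Rightarrow> 'a \<Rightarrow> complex) \<Rightarrow> 'a set
    \<Rightarrow> ('a \<Rightarrow> 'a) \<Rightarrow> ('a \<Rightarrow> 'a) \<Rightarrow> complex" where
  "End_ip scale ip W T1 T2 =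
    1 / of_nat (vector_space.dim scale W) * trace_on scale W (adjoint_on scale ip W T2 \<circ> T1)"

definition orthogonal_projection ::
  "(complex \<Rightarrow> 'a::ab_group_add \<Rightarrow> 'a) \<Rightarrow> ('a \<Rightarrow> 'a \<Rightarrow> complex) \<Rightarrow> 'a set \<Rightarrow> 'a set \<Rightarrow> ('a \<Rightarrow> 'a)
    \<Rightarrow> bool" where
  "orthogonal_projection scale ip W U P \<longleftrightarrow>
    on_dom W P \<in> lin_maps scale W scale W \<and>
    P ` W = U \<and> (\<forall>x\<in>W. P (P x) = P x) \<and> (\<forall>x\<in>W. \<forall>u\<in>U. ip (x - P x) u = 0)"

section \<open>Involutive algebras\<close>

text \<open>Algebras are not required to be unital: the unit of the Hecke algebra below is not
  the unit of the ambient group algebra.\<close>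

locale star_algebra = vector_space scale
  for scale :: "complex \<Rightarrow> 'a::ab_group_add \<Rightarrow> 'a" +
  fixes A :: "'a set" and mul :: "'a \<Rightarrow> 'a \<Rightarrow> 'a" and star :: "'a \<Rightarrow> 'a"
  assumes subspace_A: "subspace A"
    and mul_closed: "x \<in> A \<Longrightarrow> y \<in> A \<Longrightarrow> mul x y \<in> A"
    and mul_assoc: "x \<in> A \<Longrightarrow> y \<in> A \<Longrightarrow> z \<in> A \<Longrightarrow> mul (mul x y) z = mul x (mul y z)"
    and mul_add_left: "x \<in> A \<Longrightarrow> y \<in> A \<Longrightarrow> z \<in> A \<Longrightarrow> mul (x + y) z = mul x z + mul y z"
    and mul_add_right: "x \<in> A \<Longrightarrow> y \<in> A \<Longrightarrow> z \<in> A \<Longrightarrow> mul x (y + z) = mul x y + mul x z"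
    and mul_scale_left: "x \<in> A \<Longrightarrow> y \<in> A \<Longrightarrow> mul (scale c x) y = scale c (mul x y)"
    and mul_scale_right: "x \<in> A \<Longrightarrow> y \<in> A \<Longrightarrow> mul x (scale c y) = scale c (mul x y)"
    and star_closed: "x \<in> A \<Longrightarrow> star x \<in> A"
    and star_star: "x \<in> A \<Longrightarrow> star (star x) = x"
    and star_add: "x \<in> A \<Longrightarrow> y \<in> A \<Longrightarrow> star (x + y) = star x + star y"
    and star_scale: "x \<in> A \<Longrightarrow> star (scale c x) = scale (cnj c) (star x)"
    and star_mul: "x \<in> A \<Longrightarrow> y \<in> A \<Longrightarrow> star (mul x y) = mul (star y) (star x)"

definition star_subalgebra ::
  "(complex \<Rightarrow> 'a::ab_group_add \<Rightarrow> 'a) \<Rightarrow> 'a set \<Rightarrow> ('a \<Rightarrow> 'a \<Rightarrow> 'a) \<Rightarrow> ('a \<Rightarrow> 'a) \<Rightarrow> 'a set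
    \<Rightarrow> bool" where
  "star_subalgebra scale A mul star B \<longleftrightarrow>
    star_algebra scale A mul star \<and> B \<subseteq> A \<and> star_algebra scale B mul star"

definition star_anti_isomorphism ::
  "(complex \<Rightarrow> 'a::ab_group_add \<Rightarrow> 'a) \<Rightarrow> 'a set \<Rightarrow> ('a \<Rightarrow> 'a \<Rightarrow> 'a) \<Rightarrow> ('a \<Rightarrow> 'a) \<Rightarrow>
   (complex \<Rightarrow> 'b::ab_group_add \<Rightarrow> 'b) \<Rightarrow> 'b set \<Rightarrow> ('b \<Rightarrow> 'b \<Rightarrow> 'b) \<Rightarrow> ('b \<Rightarrow> 'b) \<Rightarrow>
   ('a \<Rightarrow> 'b) \<Rightarrow> bool" where
  "star_anti_isomorphism scaleA A mulA starA scaleB B mulB starB \<phi> \<longleftrightarrow>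
    star_algebra scaleA A mulA starA \<and> star_algebra scaleB B mulB starB \<and>
    bij_betw \<phi> A B \<and>
    (\<forall>x\<in>A. \<forall>y\<in>A. \<phi> (x + y) = \<phi> x + \<phi> y) \<and>
    (\<forall>c. \<forall>x\<in>A. \<phi> (scaleA c x) = scaleB c (\<phi> x)) \<and>
    (\<forall>x\<in>A. \<forall>y\<in>A. \<phi> (mulA x y) = mulB (\<phi> y) (\<phi> x)) \<and>
    (\<forall>x\<in>A. \<phi> (starA x) = starB (\<phi> x))"

section \<open>Representations\<close>

definition unitary_rep ::
  "('g, 'm) monoid_scheme \<Rightarrow> 'g set \<Rightarrow> (complex \<Rightarrow> 'v::ab_group_add \<Rightarrow> 'v) \<Rightarrow>
   ('v \<Rightarrow> 'v \<Rightarrow> complex) \<Rightarrow> ('g \<Rightarrow> 'v \<Rightarrow> 'v) \<Rightarrow> bool" where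
  "unitary_rep G K scale ip \<theta> \<longleftrightarrow>
    (\<forall>k\<in>K. Vector_Spaces.linear scale scale (\<theta> k)) \<and>
    \<theta> \<one>\<^bsub>G\<^esub> = id \<and>
    (\<forall>k1\<in>K. \<forall>k2\<in>K. \<theta> (k1 \<otimes>\<^bsub>G\<^esub> k2) = \<theta> k1 \<circ> \<theta> k2) \<and>
    (\<forall>k\<in>K. \<forall>x y. ip (\<theta> k x) (\<theta> k y) = ip x y)"

definition irreducible_rep ::
  "'g set \<Rightarrow> (complex \<Rightarrow> 'v::ab_group_add \<Rightarrow> 'v) \<Rightarrow> ('g \<Rightarrow> 'v \<Rightarrow> 'v) \<Rightarrow> bool" where
  "irreducible_rep K scale \<theta> \<longleftrightarrow>
    (UNIV :: 'v set) \<noteq> {0} \<and>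
    (\<forall>W. module.subspace scale W \<and> (\<forall>k\<in>K. \<theta> k ` W \<subseteq> W) \<longrightarrow> W = {0} \<or> W = UNIV)"

definition intertwiners ::
  "'g set \<Rightarrow> (complex \<Rightarrow> 'a::ab_group_add \<Rightarrow> 'a) \<Rightarrow> 'a set \<Rightarrow> ('g \<Rightarrow> 'a \<Rightarrow> 'a) \<Rightarrow>
   (complex \<Rightarrow> 'b::ab_group_add \<Rightarrow> 'b) \<Rightarrow> 'b set \<Rightarrow> ('g \<Rightarrow> 'b \<Rightarrow> 'b) \<Rightarrow> ('a \<Rightarrow> 'b) set" where
  "intertwiners H scale1 W1 \<rho>1 scale2 W2 \<rho>2 =
    {T \<in> lin_maps scale1 W1 scale2 W2. \<forall>h\<in>H. \<forall>x\<in>W1. T (\<rho>1 h x) = \<rho>2 h (T x)}"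

definition isomorphic_reps ::
  "'g set \<Rightarrow> (complex \<Rightarrow> 'a::ab_group_add \<Rightarrow> 'a) \<Rightarrow> 'a set \<Rightarrow> ('g \<Rightarrow> 'a \<Rightarrow> 'a) \<Rightarrow>
   (complex \<Rightarrow> 'b::ab_group_add \<Rightarrow> 'b) \<Rightarrow> 'b set \<Rightarrow> ('g \<Rightarrow> 'b \<Rightarrow> 'b) \<Rightarrow> bool" where
  "isomorphic_reps H scale1 W1 \<rho>1 scale2 W2 \<rho>2 \<longleftrightarrow>
    (\<exists>T \<in> intertwiners H scale1 W1 \<rho>1 scale2 W2 \<rho>2. bij_betw T W1 W2)"

text \<open>Left translation, used both for scalar and for vector valued functions on \<open>G\<close>.\<close>

definition ltrans :: "('g, 'm) monoid_scheme \<Rightarrow> 'g \<Rightarrow> ('g \<Rightarrow> 'b::zero) \<Rightarrow> 'g \<Rightarrow> 'b" where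
  "ltrans G h f = on_dom (carrier G) (\<lambda>g. f (inv\<^bsub>G\<^esub> h \<otimes>\<^bsub>G\<^esub> g))"

section \<open>The group algebra\<close>

abbreviation L_scale :: "complex \<Rightarrow> ('g \<Rightarrow> complex) \<Rightarrow> 'g \<Rightarrow> complex" where
  "L_scale \<equiv> fun_scale (*)"

definition L :: "('g, 'm) monoid_scheme \<Rightarrow> ('g \<Rightarrow> complex) set" where
  "L G = {f. \<forall>g. g \<notin> carrier G \<longrightarrow> f g = 0}"

definition L_conv ::
  "('g, 'm) monoid_scheme \<Rightarrow> ('g \<Rightarrow> complex) \<Rightarrow> ('g \<Rightarrow> complex) \<Rightarrow> 'g \<Rightarrow> complex" where
  "L_conv G f1 f2 =
    on_dom (carrier G) (\<lambda>g. \<Sum>h\<in>carrier G. f1 (g \<otimes>\<^bsub>G\<^esub> h) * f2 (inv\<^bsub>G\<^esub> h))"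

definition L_star :: "('g, 'm) monoid_scheme \<Rightarrow> ('g \<Rightarrow> complex) \<Rightarrow> 'g \<Rightarrow> complex" where
  "L_star G f = on_dom (carrier G) (\<lambda>g. cnj (f (inv\<^bsub>G\<^esub> g)))"

definition L_ip ::
  "('g, 'm) monoid_scheme \<Rightarrow> ('g \<Rightarrow> complex) \<Rightarrow> ('g \<Rightarrow> complex) \<Rightarrow> complex" where
  "L_ip G f1 f2 = (\<Sum>g\<in>carrier G. f1 g * cnj (f2 g))"

section \<open>The induced representation\<close>

definition Ind ::
  "('g, 'm) monoid_scheme \<Rightarrow> 'g set \<Rightarrow> ('g \<Rightarrow> 'v \<Rightarrow> 'v) \<Rightarrow> ('g \<Rightarrow> 'v::ab_group_add) set" where
  "Ind G K \<theta> =
    {f. (\<forall>g. g \<notin> carrier G \<longrightarrow> f g = 0) \<and>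
        (\<forall>g\<in>carrier G. \<forall>k\<in>K. f (g \<otimes>\<^bsub>G\<^esub> k) = \<theta> (inv\<^bsub>G\<^esub> k) (f g))}"

definition Ind_ip ::
  "('g, 'm) monoid_scheme \<Rightarrow> 'g set \<Rightarrow> ('v \<Rightarrow> 'v \<Rightarrow> complex) \<Rightarrow> ('g \<Rightarrow> 'v) \<Rightarrow> ('g \<Rightarrow> 'v)
    \<Rightarrow> complex" where
  "Ind_ip G K ip f1 f2 = 1 / of_nat (card K) * (\<Sum>g\<in>carrier G. ip (f1 g) (f2 g))"

section \<open>The Hecke algebra of operator valued functions\<close>

abbreviation HT_scale ::
  "(complex \<Rightarrow> 'v \<Rightarrow> 'v) \<Rightarrow> complex \<Rightarrow> ('g \<Rightarrow> 'v \<Rightarrow> 'v) \<Rightarrow> 'g \<Rightarrow> 'v \<Rightarrow> 'v" where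
  "HT_scale scale \<equiv> fun_scale (fun_scale scale)"

definition HT ::
  "('g, 'm) monoid_scheme \<Rightarrow> 'g set \<Rightarrow> (complex \<Rightarrow> 'v::ab_group_add \<Rightarrow> 'v) \<Rightarrow> ('g \<Rightarrow> 'v \<Rightarrow> 'v)
    \<Rightarrow> ('g \<Rightarrow> 'v \<Rightarrow> 'v) set" where
  "HT G K scale \<theta> =
    {F. (\<forall>g. g \<notin> carrier G \<longrightarrow> F g = 0) \<and>
        (\<forall>g\<in>carrier G. Vector_Spaces.linear scale scale (F g)) \<and>
        (\<forall>g\<in>carrier G. \<forall>k1\<in>K. \<forall>k2\<in>K.
          F (k1 \<otimes>\<^bsub>G\<^esub> g \<otimes>\<^bsub>G\<^esub> k2) = \<theta> (inv\<^bsub>G\<^esub> k2) \<circ> F g \<circ> \<theta> (inv\<^bsub>G\<^esub> k1))}"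

definition HT_conv ::
  "('g, 'm) monoid_scheme \<Rightarrow> ('g \<Rightarrow> 'v \<Rightarrow> 'v::ab_group_add) \<Rightarrow> ('g \<Rightarrow> 'v \<Rightarrow> 'v) \<Rightarrow> 'g \<Rightarrow> 'v \<Rightarrow> 'v" where
  "HT_conv G F1 F2 =
    on_dom (carrier G) (\<lambda>g. \<Sum>h\<in>carrier G. F1 (inv\<^bsub>G\<^esub> h \<otimes>\<^bsub>G\<^esub> g) \<circ> F2 h)"

definition HT_star ::
  "('g, 'm) monoid_scheme \<Rightarrow> (complex \<Rightarrow> 'v::ab_group_add \<Rightarrow> 'v) \<Rightarrow> ('v \<Rightarrow> 'v \<Rightarrow> complex) \<Rightarrow>
   ('g \<Rightarrow> 'v \<Rightarrow> 'v) \<Rightarrow> 'g \<Rightarrow> 'v \<Rightarrow> 'v" where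
  "HT_star G scale ip F =
    on_dom (carrier G) (\<lambda>g. adjoint_on scale ip UNIV (F (inv\<^bsub>G\<^esub> g)))"

definition HT_ip ::
  "('g, 'm) monoid_scheme \<Rightarrow> (complex \<Rightarrow> 'v::ab_group_add \<Rightarrow> 'v) \<Rightarrow> ('v \<Rightarrow> 'v \<Rightarrow> complex) \<Rightarrow>
   ('g \<Rightarrow> 'v \<Rightarrow> 'v) \<Rightarrow> ('g \<Rightarrow> 'v \<Rightarrow> 'v) \<Rightarrow> complex" where
  "HT_ip G scale ip F1 F2 = (\<Sum>g\<in>carrier G. End_ip scale ip UNIV (F1 g) (F2 g))"

definition xi ::
  "('g, 'm) monoid_scheme \<Rightarrow> ('g \<Rightarrow> 'v \<Rightarrow> 'v) \<Rightarrow> ('g \<Rightarrow> 'v::ab_group_add) \<Rightarrow> 'g \<Rightarrow> 'v" where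
  "xi G F f =
    on_dom (carrier G) (\<lambda>g. \<Sum>h\<in>carrier G. F (inv\<^bsub>G\<^esub> h \<otimes>\<^bsub>G\<^esub> g) (f h))"

section \<open>The vector \<open>v\<close> and the associated objects in the group algebra\<close>

definition psi ::
  "'g set \<Rightarrow> (complex \<Rightarrow> 'v::ab_group_add \<Rightarrow> 'v) \<Rightarrow> ('v \<Rightarrow> 'v \<Rightarrow> complex) \<Rightarrow> ('g \<Rightarrow> 'v \<Rightarrow> 'v) \<Rightarrow> 'v
    \<Rightarrow> 'g \<Rightarrow> complex" where
  "psi K scale ip \<theta> v =
    on_dom K (\<lambda>k. of_nat (vector_space.dim scale UNIV) / of_nat (card K) * ip v (\<theta> k v))"

definition Tv ::
  "'g set \<Rightarrow> (complex \<Rightarrow> 'v::ab_group_add \<Rightarrow> 'v) \<Rightarrow> ('v \<Rightarrow> 'v \<Rightarrow> complex) \<Rightarrow> 'v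
    \<Rightarrow> ('g \<Rightarrow> 'v) \<Rightarrow> 'g \<Rightarrow> complex" where
  "Tv K scale ip v f =
    (\<lambda>g. complex_of_real (sqrt (real (vector_space.dim scale UNIV) / real (card K))) * ip (f g) v)"

definition Sv ::
  "(complex \<Rightarrow> 'v::ab_group_add \<Rightarrow> 'v) \<Rightarrow> ('v \<Rightarrow> 'v \<Rightarrow> complex) \<Rightarrow> 'v
    \<Rightarrow> ('g \<Rightarrow> 'v \<Rightarrow> 'v) \<Rightarrow> 'g \<Rightarrow> complex" where
  "Sv scale ip v F = (\<lambda>g. of_nat (vector_space.dim scale UNIV) * ip (F g v) v)"

definition Hpsi :: "('g, 'm) monoid_scheme \<Rightarrow> ('g \<Rightarrow> complex) \<Rightarrow> ('g \<Rightarrow> complex) set" where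
  "Hpsi G p = {L_conv G (L_conv G p f) p |f. f \<in> L G}"

section \<open>Double cosets\<close>

definition dcoset :: "('g, 'm) monoid_scheme \<Rightarrow> 'g set \<Rightarrow> 'g \<Rightarrow> 'g set" where
  "dcoset G K s = (K #>\<^bsub>G\<^esub> s) <#>\<^bsub>G\<^esub> K"

definition dcoset_reps :: "('g, 'm) monoid_scheme \<Rightarrow> 'g set \<Rightarrow> 'g set \<Rightarrow> bool" where
  "dcoset_reps G K S \<longleftrightarrow>
    S \<subseteq> carrier G \<and> (\<forall>g\<in>carrier G. \<exists>!s. s \<in> S \<and> g \<in> dcoset G K s)"

definition conj_inter :: "('g, 'm) monoid_scheme \<Rightarrow> 'g set \<Rightarrow> 'g \<Rightarrow> 'g set" where
  "conj_inter G K s = K \<inter> (s <#\<^bsub>G\<^esub> K #>\<^bsub>G\<^esub> inv\<^bsub>G\<^esub> s)"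

definition conj_rep ::
  "('g, 'm) monoid_scheme \<Rightarrow> ('g \<Rightarrow> 'v \<Rightarrow> 'v) \<Rightarrow> 'g \<Rightarrow> 'g \<Rightarrow> 'v \<Rightarrow> 'v" where
  "conj_rep G \<theta> s x = \<theta> (inv\<^bsub>G\<^esub> s \<otimes>\<^bsub>G\<^esub> x \<otimes>\<^bsub>G\<^esub> s)"

definition supp_reps ::
  "('g, 'm) monoid_scheme \<Rightarrow> 'g set \<Rightarrow> (complex \<Rightarrow> 'v::ab_group_add \<Rightarrow> 'v) \<Rightarrow> ('g \<Rightarrow> 'v \<Rightarrow> 'v)
    \<Rightarrow> 'g set \<Rightarrow> 'g set" where
  "supp_reps G K scale \<theta> S =
    {s \<in> S. intertwiners (conj_inter G K s) scale UNIV \<theta> scale UNIV (conj_rep G \<theta> s) \<noteq> {0}}"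

end

theory Submission
  imports Defs "HOL-Computational_Algebra.Fundamental_Theorem_Algebra"
begin

text \<open>
  Schur's lemma makes the orbit \<open>\<theta>(k) v\<close> a tight frame:
  \<open>\<Sum>k. \<langle>u, \<theta>(k) v\<rangle> \<theta>(k) v = (|K| / d) u\<close>. Averaging a sum over \<open>G\<close> over cosets of \<open>K\<close>
  and collapsing it with this identity gives the isometry of \<open>T\<^sub>v\<close>, the idempotence of
  \<open>\<psi>\<close>, the intertwining relation between \<open>\<xi>(F)\<close> and convolution with \<open>S\<^sub>v F\<close>, and the
  inversion formula for \<open>S\<^sub>v\<close>. Since \<open>S\<^sub>v F\<close> is a multiple of \<open>T\<^sub>v\<close> applied to
  \<open>g \<mapsto> F(g) v\<close>, the multiplicativity of \<open>S\<^sub>v\<close> is a case of the intertwining relation.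
  Part (4) holds for every self-adjoint idempotent \<open>p\<close> of the group algebra: an endomorphism
  \<open>U\<close> of \<open>L(G) * p\<close> is right convolution with \<open>U p\<close>, and the translates of \<open>p\<close> form a
  Parseval frame of \<open>L(G) * p\<close>, which computes the traces.
\<close>

section \<open>Linear algebra\<close>

text \<open>The orbit of v enters through covariance: f(gk) = \<theta>(k^-1) f(g) and unitarity give
  <f(gk), v> = <f(g), \<theta>(k) v>. So the values of \<open>T f\<close> on a coset gK are, up to a
  constant, the frame coefficients of the single vector f(g). They determine that vector, and \<psi>
  is the reproducing kernel that projects an arbitrary function on gK onto such coefficient
  families. This is also the origin of the constants: with frame bound q = |K|/d, the map T carries
  the factor q^(-1/2) in order to be isometric and \<psi> the factor 1/q in order to be idempotent.
  A function F in the Hecke algebra is covariant on both sides, so its inversion formula uses the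
  frame twice. The star algebra axioms for the operator valued functions and for the endomorphisms
  are not checked by hand: both spaces embed, with products reversed, into the functions f = \<psi>
  * f * \<psi>, and they inherit the axioms from there.\<close>

lemma sum_fun_apply: "(\<Sum>a\<in>A. f a) x = (\<Sum>a\<in>A. f a x)"
  by (induction A rule: infinite_finite_induct) auto

lemma vector_space_fun_scale:
  assumes "vector_space scale"
  shows "vector_space (fun_scale scale)"
proof -
  interpret vector_space scale by fact
  show ?thesis
    by unfold_locales (auto simp: fun_scale_def fun_eq_iff scale_right_distrib scale_left_distrib)
qed

lemma vector_space_mult: "vector_space ((*) :: 'a::field \<Rightarrow> 'a \<Rightarrow> 'a)"
  by unfold_locales (auto simp: algebra_simps)

locale complex_vector_space = vector_space scale for scale :: "complex \<Rightarrow> 'a::ab_group_add \<Rightarrow> 'a"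
begin

lemma lin_maps_zero:
  assumes "T \<in> lin_maps scale W s2 W2" "subspace W" "vector_space s2"
  shows "T 0 = 0"
proof -
  interpret t: vector_space s2 by fact
  have "T (scale 0 0) = s2 0 (T 0)"
    using assms subspace_0 unfolding lin_maps_def by blast
  then show ?thesis by simp
qed

lemma lin_maps_sum:
  assumes T: "T \<in> lin_maps scale W s2 W2" and W: "subspace W" and s2: "vector_space s2"
    and x: "\<And>a. a \<in> A \<Longrightarrow> x a \<in> W"
  shows "T (\<Sum>a\<in>A. scale (c a) (x a)) = (\<Sum>a\<in>A. s2 (c a) (T (x a)))"
  using x
proof (induction A rule: infinite_finite_induct)
  case (insert a A)
  then have "scale (c a) (x a) \<in> W" "(\<Sum>a\<in>A. scale (c a) (x a)) \<in> W"
    using W by (auto intro!: subspace_scale subspace_sum)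
  then show ?case
    using insert T by (auto simp: lin_maps_def)
qed (use lin_maps_zero[OF T W s2] in auto)

lemma lin_maps_UNIV_iff:
  "T \<in> lin_maps scale UNIV scale UNIV \<longleftrightarrow> Vector_Spaces.linear scale scale T"
  by (auto simp: lin_maps_def linear_iff_module_hom module_hom_iff module_axioms)

text \<open>\<open>trace_on\<close> selects a basis by \<open>SOME\<close>, so its value is
  accessible only if a basis exists and whichever one is selected is finite; a sum over an infinite
  basis would be 0. The finite family x spans W and bounds every basis.\<close>

lemma framed_subspace_basis:
  assumes W: "subspace W" and x: "\<And>a. a \<in> A \<Longrightarrow> x a \<in> W" and A: "finite A"
    and frame: "\<And>w. w \<in> W \<Longrightarrow> w = (\<Sum>a\<in>A. scale (l a w) (x a))"
  shows "\<exists>B. independent B \<and> span B = W"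
    and "\<And>B. independent B \<Longrightarrow> span B = W \<Longrightarrow> finite B"
proof -
  obtain B where B: "B \<subseteq> W" "independent B" "W \<subseteq> span B"
    using basis_exists[of W] by metis
  have "span B = W"
    using span_minimal[OF B(1) W] B(3) by (rule subset_antisym)
  with B(2) show "\<exists>B. independent B \<and> span B = W" by blast
  have *: "W \<subseteq> span (x ` A)"
  proof
    fix w assume "w \<in> W"
    then have "w = (\<Sum>a\<in>A. scale (l a w) (x a))" by (rule frame)
    also have "\<dots> \<in> span (x ` A)" by (intro span_sum span_scale span_base) auto
    finally show "w \<in> span (x ` A)" .
  qed
  show "finite B" if B: "independent B" "span B = W" for B
  proof -
    have "B \<subseteq> span (x ` A)" using B(2) * span_superset[of B] by simp
    then show ?thesis using independent_span_bound[OF finite_imageI[OF A] B(1)] by simp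
  qed
qed

text \<open>Let L take the coefficients l and let X be the synthesis by x, so that X L is the
  identity on W. Then T = T X L has the trace of L T X, whose diagonal entries are the summands on
  the right. Linear independence of x plays no part in this, so overcomplete families adapted to a
  group action can be used.\<close>

lemma trace_on_frame:
  assumes W: "subspace W" and x: "\<And>a. a \<in> A \<Longrightarrow> x a \<in> W" and A: "finite A"
    and frame: "\<And>w. w \<in> W \<Longrightarrow> w = (\<Sum>a\<in>A. scale (l a w) (x a))"
    and l: "\<And>a. a \<in> A \<Longrightarrow> on_dom W (l a) \<in> lin_maps scale W (*) UNIV"
    and T: "T \<in> lin_maps scale W scale W"
  shows "trace_on scale W T = (\<Sum>a\<in>A. l a (T (x a)))"
proof -
  define B where "B = (SOME B. independent B \<and> span B = W)"
  have B: "independent B \<and> span B = W"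
    unfolding B_def by (rule someI_ex) (rule framed_subspace_basis(1)[OF W x A frame])
  then have fB: "finite B"
    using framed_subspace_basis(2)[OF W x A frame] by blast
  have BW: "b \<in> W" if "b \<in> B" for b
    using B span_base that by blast
  have TW: "T w \<in> W" if "w \<in> W" for w
    using T that by (auto simp: lin_maps_def)
  have l': "l a (\<Sum>b\<in>B. scale (c b) b) = (\<Sum>b\<in>B. c b * l a b)" if "a \<in> A" for a c
  proof -
    have "on_dom W (l a) (\<Sum>b\<in>B. scale (c b) b) = (\<Sum>b\<in>B. c b * on_dom W (l a) b)"
      using BW by (intro lin_maps_sum[OF l[OF that] W vector_space_mult]) auto
    moreover have "(\<Sum>b\<in>B. scale (c b) b) \<in> W"
      using BW W by (intro subspace_sum subspace_scale)
    ultimately show ?thesis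
      using BW by (simp add: on_dom_def)
  qed
  have "(\<Sum>b\<in>B. representation B (T b) b)
      = (\<Sum>b\<in>B. \<Sum>a\<in>A. l a b * representation B (T (x a)) b)"
  proof (rule sum.cong)
    fix b assume b: "b \<in> B"
    have "T b = T (\<Sum>a\<in>A. scale (l a b) (x a))"
      using frame[OF BW[OF b]] by simp
    also have "\<dots> = (\<Sum>a\<in>A. scale (l a b) (T (x a)))"
      by (rule lin_maps_sum[OF T W vector_space_axioms x])
    finally have "T b = (\<Sum>a\<in>A. scale (l a b) (T (x a)))" .
    moreover have "T (x a) \<in> span B" if "a \<in> A" for a
      using B x TW that by blast
    ultimately show "representation B (T b) b = (\<Sum>a\<in>A. l a b * representation B (T (x a)) b)"
      using conjunct1[OF B] by (simp add: representation_sum representation_scale span_scale)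
  qed simp
  also have "\<dots> = (\<Sum>a\<in>A. \<Sum>b\<in>B. representation B (T (x a)) b * l a b)"
    by (subst sum.swap) (simp add: mult.commute)
  also have "\<dots> = (\<Sum>a\<in>A. l a (T (x a)))"
  proof (rule sum.cong)
    fix a assume a: "a \<in> A"
    have "(\<Sum>b\<in>B. scale (representation B (T (x a)) b) b) = T (x a)"
      using B fB TW[OF x[OF a]] by (intro sum_representation_eq) auto
    then show "(\<Sum>b\<in>B. representation B (T (x a)) b * l a b) = l a (T (x a))"
      using l'[OF a, of "\<lambda>b. representation B (T (x a)) b"] by simp
  qed simp
  finally show ?thesis
    unfolding trace_on_def Let_def B_def .
qed

end

context vector_space
begin

text \<open>A polynomial in \<open>A\<close> of least degree annihilating \<open>x\<close> has a root, and the cofactor of that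
  root maps \<open>x\<close> to an eigenvector.\<close>

lemma eigenvector_exists:
  assumes A: "Vector_Spaces.linear scale scale A" and x: "x \<noteq> (0::'b)"
    and root: "\<And>p::'a poly. degree p > 0 \<Longrightarrow> \<exists>z. poly p z = 0"
    and fd: "finite B" "span B = UNIV"
  shows "\<exists>z y. y \<noteq> 0 \<and> A y = scale z y"
proof -
  interpret A: Vector_Spaces.linear scale scale A by fact
  define w where "w i = (A ^^ i) x" for i
  \<comment> \<open>This is p(A) x, written out on the iterates of x so that no ring of operators
    has to be set up.\<close>
  define ev where "ev p = (\<Sum>i\<le>degree p. scale (coeff p i) (w i))" for p
  have ev_eq: "ev p = (\<Sum>i\<le>n. scale (coeff p i) (w i))" if "degree p \<le> n" for p n
    unfolding ev_def using that
    by (intro sum.mono_neutral_left) (auto simp: coeff_eq_0)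
  have ev_pCons0: "ev (pCons 0 p) = A (ev p)" for p
  proof -
    have "ev (pCons 0 p) = (\<Sum>i\<le>Suc (degree p). scale (coeff (pCons 0 p) i) (w i))"
      by (rule ev_eq) (rule degree_pCons_le)
    also have "\<dots> = (\<Sum>i\<le>degree p. scale (coeff p i) (w (Suc i)))"
      by (subst sum.atMost_Suc_shift) simp
    also have "\<dots> = A (ev p)"
      by (simp add: ev_def A.sum A.scale w_def)
    finally show ?thesis .
  qed
  have ev_diff: "ev (p - smult z q) = ev p - scale z (ev q)" for p q z
  proof -
    let ?n = "max (degree p) (degree q)"
    have "degree (smult z q) \<le> ?n"
      by (meson degree_smult_le dual_order.trans max.cobounded2)
    then have "degree (p - smult z q) \<le> ?n"
      by (intro degree_diff_le) auto
    then have "ev (p - smult z q) = (\<Sum>i\<le>?n. scale (coeff (p - smult z q) i) (w i))"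
      by (rule ev_eq)
    also have "\<dots> = ev p - scale z (ev q)"
      by (simp add: ev_eq[of p ?n] ev_eq[of q ?n] scale_left_diff_distrib sum_subtractf
          scale_sum_right)
    finally show ?thesis .
  qed
  have "\<exists>p. p \<noteq> 0 \<and> ev p = 0"
  \<comment> \<open>Dependence is a property of sets, not of families. Distinct iterates form a set
    too large to be independent; a coincidence w i = w j is itself a relation, given by X^i -
    X^j.\<close>
  proof (cases "inj_on w {..card B}")
    case True
    then have "card (w ` {..card B}) = Suc (card B)"
      by (simp add: card_image)
    then have "dependent (w ` {..card B})"
      using independent_span_bound[of B "w ` {..card B}"] fd by auto
    then obtain u where u: "\<exists>y\<in>w ` {..card B}. u y \<noteq> 0"
      and s: "(\<Sum>y\<in>w ` {..card B}. scale (u y) y) = 0"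
      by (subst (asm) dependent_finite) auto
    define p where "p = (\<Sum>i\<le>card B. monom (u (w i)) i)"
    have c: "coeff p i = (if i \<le> card B then u (w i) else 0)" for i
      by (auto simp: p_def coeff_sum)
    then have "degree p \<le> card B"
      by (intro degree_le) auto
    then have "ev p = (\<Sum>i\<le>card B. scale (u (w i)) (w i))"
      by (simp add: ev_eq c)
    also have "\<dots> = 0"
      using s by (simp add: sum.reindex[OF True])
    finally have "ev p = 0" .
    moreover have "p \<noteq> 0"
      using u c by (metis atMost_iff coeff_0 imageE)
    ultimately show ?thesis by blast
  next
    case False
    then obtain i j where ij: "i \<noteq> j" "w i = w j"
      by (auto simp: inj_on_def)
    have m: "ev (monom 1 k) = w k" for k
    proof -
      have "ev (monom 1 k) = (\<Sum>i\<le>k. scale (coeff (monom 1 k) i) (w i))"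
        by (rule ev_eq) (rule degree_monom_le)
      also have "\<dots> = (\<Sum>i\<le>k. if i = k then w i else 0)"
        by (rule sum.cong) auto
      finally show ?thesis by simp
    qed
    \<comment> \<open>The factor \<open>smult 1\<close> brings the difference into the shape of
      \<open>ev_diff\<close>.\<close>
    have "ev (monom 1 i - smult 1 (monom 1 j)) = 0"
      by (subst ev_diff) (simp add: m ij)
    moreover have "coeff (monom 1 i - smult 1 (monom 1 j)) i \<noteq> (0::'a)"
      using ij by simp
    ultimately show ?thesis by (metis coeff_0)
  qed
  then obtain p where p: "p \<noteq> 0" "ev p = 0"
    and least: "\<And>q. q \<noteq> 0 \<Longrightarrow> ev q = 0 \<Longrightarrow> degree p \<le> degree q"
    using ex_has_least_nat[of "\<lambda>p. p \<noteq> 0 \<and> ev p = 0" _ degree] by metis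
  have "degree p > 0"
  proof (rule ccontr)
    assume "\<not> degree p > 0"
    then obtain c where "p = [:c:]" by (metis degree_eq_zeroE not_gr0)
    with p x show False by (simp add: ev_def w_def)
  qed
  then obtain z where "poly p z = 0" using root by blast
  then obtain q where q: "p = [:- z, 1:] * q"
    using poly_eq_0_iff_dvd by blast
  with p have "q \<noteq> 0" by auto
  moreover from this have "degree p = Suc (degree q)"
    unfolding q by (subst degree_mult_eq) auto
  ultimately have "ev q \<noteq> 0" using least[of q] by fastforce
  moreover have "p = pCons 0 q - smult z q" by (simp add: q)
  then have "A (ev q) = scale z (ev q)"
    using p(2) by (simp add: ev_diff ev_pCons0)
  ultimately show ?thesis by blast
qed

end

section \<open>Inner products, adjoints, and transport of star algebra structures\<close>

sublocale fd_inner_product_space \<subseteq> complex_vector_space scale ..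

context fd_inner_product_space
begin

lemma ip_add_right: "ip x (y + z) = ip x y + ip x z"
  by (metis ip_commute ip_add_left complex_cnj_add)

lemma ip_scale_right: "ip x (scale c y) = cnj c * ip x y"
  by (metis ip_commute ip_scale_left complex_cnj_mult)

lemma ip_zero_left [simp]: "ip 0 x = 0"
  using ip_scale_left[of 0 0 x] by simp

lemma ip_zero_right [simp]: "ip x 0 = 0"
  using ip_scale_right[of x 0 0] by simp

lemma ip_sum_left: "ip (\<Sum>a\<in>A. f a) y = (\<Sum>a\<in>A. ip (f a) y)"
  by (induction A rule: infinite_finite_induct) (auto simp: ip_add_left)

lemma ip_sum_right: "ip y (\<Sum>a\<in>A. f a) = (\<Sum>a\<in>A. ip y (f a))"
  by (induction A rule: infinite_finite_induct) (auto simp: ip_add_right)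

lemma ip_ext_right:
  assumes "\<And>x. ip x y = ip x z"
  shows "y = z"
proof (rule ccontr)
  assume "y \<noteq> z"
  then have "Re (ip (y - z) (y - z)) > 0" by (intro ip_pos) simp
  moreover have "ip (y - z) y = ip (y - z) (y - z) + ip (y - z) z"
    by (metis diff_add_cancel ip_add_right)
  ultimately show False by (simp add: assms)
qed

lemma ip_ext_left: "(\<And>x. ip y x = ip z x) \<Longrightarrow> y = z"
  by (rule ip_ext_right) (metis ip_commute)

end

text \<open>Stated for a subspace with a form that is nondegenerate there, because
  \<open>L_ip G\<close> is definite only on functions vanishing off \<open>carrier G\<close> and not
  on the whole type. Two candidates for the adjoint differ at y by a vector of W orthogonal to
  itself.\<close>

lemma adjoint_on_eq:
  assumes "vector_space scale" and W: "module.subspace scale W"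
    and add: "\<And>x y z. x \<in> W \<Longrightarrow> y \<in> W \<Longrightarrow> z \<in> W \<Longrightarrow> ip x (y + z) = ip x y + ip x z"
    and nondeg: "\<And>x. x \<in> W \<Longrightarrow> ip x x = 0 \<Longrightarrow> x = 0"
    and T': "T' \<in> lin_maps scale W scale W"
    and adj: "\<And>x y. x \<in> W \<Longrightarrow> y \<in> W \<Longrightarrow> ip (T x) y = ip x (T' y)"
  shows "adjoint_on scale ip W T = T'"
  unfolding adjoint_on_def
proof (rule the_equality)
  show "T' \<in> lin_maps scale W scale W \<and> (\<forall>x\<in>W. \<forall>y\<in>W. ip (T x) y = ip x (T' y))"
    using T' adj by blast
next
  interpret vector_space scale by fact
  fix U assume U: "U \<in> lin_maps scale W scale W \<and> (\<forall>x\<in>W. \<forall>y\<in>W. ip (T x) y = ip x (U y))"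
  show "U = T'"
  proof
    fix y
    show "U y = T' y"
    proof (cases "y \<in> W")
      case True
      have mem: "U y \<in> W" "T' y \<in> W"
        using True U T' by (auto simp: lin_maps_def)
      let ?z = "U y - T' y"
      have z: "?z \<in> W" using W mem by (rule subspace_diff)
      have "ip ?z (?z + T' y) = ip ?z ?z + ip ?z (T' y)"
        using add z mem by blast
      moreover have "ip ?z (U y) = ip ?z (T' y)"
        using U adj z True by metis
      ultimately have "ip ?z ?z = 0" by simp
      then show ?thesis using nondeg z by fastforce
    qed (use U T' in \<open>auto simp: lin_maps_def\<close>)
  qed
qed

text \<open>By injectivity each axiom may be checked after applying \<phi>. Since \<phi> reverses
  products, every left-hand law of A comes from the right-hand law of B, and conversely.\<close>

lemma star_algebra_pullback:
  assumes B: "star_algebra scaleB B mulB starB"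
    and sA: "vector_space scaleA" and A: "module.subspace scaleA A"
    and inj: "inj_on \<phi> A" and \<phi>: "\<And>x. x \<in> A \<Longrightarrow> \<phi> x \<in> B"
    and mulA: "\<And>x y. x \<in> A \<Longrightarrow> y \<in> A \<Longrightarrow> mulA x y \<in> A"
    and starA: "\<And>x. x \<in> A \<Longrightarrow> starA x \<in> A"
    and add: "\<And>x y. x \<in> A \<Longrightarrow> y \<in> A \<Longrightarrow> \<phi> (x + y) = \<phi> x + \<phi> y"
    and scale: "\<And>c x. x \<in> A \<Longrightarrow> \<phi> (scaleA c x) = scaleB c (\<phi> x)"
    and mul: "\<And>x y. x \<in> A \<Longrightarrow> y \<in> A \<Longrightarrow> \<phi> (mulA x y) = mulB (\<phi> y) (\<phi> x)"
    and star: "\<And>x. x \<in> A \<Longrightarrow> \<phi> (starA x) = starB (\<phi> x)"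
  shows "star_algebra scaleA A mulA starA"
proof -
  interpret vector_space scaleA by fact
  interpret B: star_algebra scaleB B mulB starB by fact
  have A_add: "x + y \<in> A" if "x \<in> A" "y \<in> A" for x y
    using A that by (rule subspace_add)
  have A_scale: "scaleA c x \<in> A" if "x \<in> A" for x c
    using A that by (rule subspace_scale)
  note eqI = inj_onD[OF inj]
  note hom = add scale mul star A_add A_scale mulA starA \<phi>
  show ?thesis
  proof unfold_locales
    fix x y z c
    show "subspace A" by (fact A)
    show "x \<in> A \<Longrightarrow> y \<in> A \<Longrightarrow> mulA x y \<in> A" by (fact mulA)
    show "x \<in> A \<Longrightarrow> starA x \<in> A" by (fact starA)
    show "x \<in> A \<Longrightarrow> y \<in> A \<Longrightarrow> z \<in> A \<Longrightarrow> mulA (mulA x y) z = mulA x (mulA y z)"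
      by (rule eqI) (simp_all add: hom B.mul_assoc)
    show "x \<in> A \<Longrightarrow> y \<in> A \<Longrightarrow> z \<in> A \<Longrightarrow> mulA (x + y) z = mulA x z + mulA y z"
      by (rule eqI) (simp_all add: hom B.mul_add_right)
    show "x \<in> A \<Longrightarrow> y \<in> A \<Longrightarrow> z \<in> A \<Longrightarrow> mulA x (y + z) = mulA x y + mulA x z"
      by (rule eqI) (simp_all add: hom B.mul_add_left)
    show "x \<in> A \<Longrightarrow> y \<in> A \<Longrightarrow> mulA (scaleA c x) y = scaleA c (mulA x y)"
      by (rule eqI) (simp_all add: hom B.mul_scale_right)
    show "x \<in> A \<Longrightarrow> y \<in> A \<Longrightarrow> mulA x (scaleA c y) = scaleA c (mulA x y)"
      by (rule eqI) (simp_all add: hom B.mul_scale_left)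
    show "x \<in> A \<Longrightarrow> starA (starA x) = x"
      by (rule eqI) (simp_all add: hom B.star_star)
    show "x \<in> A \<Longrightarrow> y \<in> A \<Longrightarrow> starA (x + y) = starA x + starA y"
      by (rule eqI) (simp_all add: hom B.star_add)
    show "x \<in> A \<Longrightarrow> starA (scaleA c x) = scaleA (cnj c) (starA x)"
      by (rule eqI) (simp_all add: hom B.star_scale)
    show "x \<in> A \<Longrightarrow> y \<in> A \<Longrightarrow> starA (mulA x y) = mulA (starA y) (starA x)"
      by (rule eqI) (simp_all add: hom B.star_mul)
  qed
qed

section \<open>The group algebra\<close>

context group
begin

lemma inv_mult_cancel: "x \<in> carrier G \<Longrightarrow> y \<in> carrier G \<Longrightarrow> inv x \<otimes> (x \<otimes> y) = y"
  by (simp add: m_assoc[symmetric])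

lemma mult_inv_cancel: "x \<in> carrier G \<Longrightarrow> y \<in> carrier G \<Longrightarrow> x \<otimes> (inv x \<otimes> y) = y"
  by (simp add: m_assoc[symmetric])

lemma sum_subgroup_left:
  assumes H: "subgroup H G" and x: "x \<in> H"
  shows "(\<Sum>k\<in>H. f (x \<otimes> k)) = (\<Sum>k\<in>H. f k)"
  by (rule sum.reindex_bij_witness[of _ "\<lambda>k. inv x \<otimes> k" "\<lambda>k. x \<otimes> k"])
    (use subgroup.mem_carrier[OF H] subgroup.m_closed[OF H] subgroup.m_inv_closed[OF H] x
      in \<open>auto simp: inv_mult_cancel mult_inv_cancel\<close>)

lemma sum_subgroup_right:
  assumes H: "subgroup H G" and x: "x \<in> H"
  shows "(\<Sum>k\<in>H. f (k \<otimes> x)) = (\<Sum>k\<in>H. f k)"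
  by (rule sum.reindex_bij_witness[of _ "\<lambda>k. k \<otimes> inv x" "\<lambda>k. k \<otimes> x"])
    (use subgroup.mem_carrier[OF H] subgroup.m_closed[OF H] subgroup.m_inv_closed[OF H] x
      in \<open>auto simp: m_assoc\<close>)

lemmas sum_carrier_left = sum_subgroup_left[OF subgroup_self]
lemmas sum_carrier_right = sum_subgroup_right[OF subgroup_self]

lemma subspace_L: "module.subspace L_scale (L G)"
proof -
  interpret vector_space "L_scale :: complex \<Rightarrow> ('a \<Rightarrow> complex) \<Rightarrow> _"
    by (rule vector_space_fun_scale[OF vector_space_mult])
  show ?thesis by (rule subspaceI) (auto simp: L_def fun_scale_def)
qed

lemma L_conv_apply:
  assumes "g \<in> carrier G"
  shows "L_conv G f p g = (\<Sum>h\<in>carrier G. f h * p (inv h \<otimes> g))"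
proof -
  have "(\<Sum>h\<in>carrier G. f h * p (inv h \<otimes> g))
      = (\<Sum>h\<in>carrier G. f (g \<otimes> h) * p (inv (g \<otimes> h) \<otimes> g))"
    using assms by (rule sum_carrier_left[symmetric])
  also have "\<dots> = (\<Sum>h\<in>carrier G. f (g \<otimes> h) * p (inv h))"
    using assms by (intro sum.cong) (auto simp: inv_mult_group m_assoc)
  finally show ?thesis
    using assms by (simp add: L_conv_def on_dom_def)
qed

lemma L_conv_outside: "g \<notin> carrier G \<Longrightarrow> L_conv G f p g = 0"
  by (simp add: L_conv_def on_dom_def)

lemma L_conv_in_L [simp]: "L_conv G f p \<in> L G"
  by (simp add: L_def L_conv_outside)

lemma L_star_in_L [simp]: "L_star G f \<in> L G"
  by (simp add: L_def L_star_def on_dom_def)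

lemma ltrans_in_L [simp]: "ltrans G x f \<in> L G"
  by (simp add: L_def ltrans_def on_dom_def)

lemma L_ext: "(\<And>g. g \<in> carrier G \<Longrightarrow> f g = p g) \<Longrightarrow> f \<in> L G \<Longrightarrow> p \<in> L G \<Longrightarrow> f = p"
  by (rule ext, rename_tac g, case_tac "g \<in> carrier G") (auto simp: L_def)

lemma L_star_apply: "g \<in> carrier G \<Longrightarrow> L_star G f g = cnj (f (inv g))"
  by (simp add: L_star_def on_dom_def)

lemma ltrans_apply: "g \<in> carrier G \<Longrightarrow> ltrans G x f g = f (inv x \<otimes> g)"
  by (simp add: ltrans_def on_dom_def)

lemma L_conv_assoc: "L_conv G (L_conv G f1 f2) f3 = L_conv G f1 (L_conv G f2 f3)"
proof (rule L_ext)
  fix g assume g: "g \<in> carrier G"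
  have "L_conv G (L_conv G f1 f2) f3 g
      = (\<Sum>h\<in>carrier G. \<Sum>x\<in>carrier G. f1 x * f2 (inv x \<otimes> h) * f3 (inv h \<otimes> g))"
    using g by (simp add: L_conv_apply sum_distrib_right)
  also have "\<dots> = (\<Sum>x\<in>carrier G. \<Sum>h\<in>carrier G. f1 x * f2 (inv x \<otimes> h) * f3 (inv h \<otimes> g))"
    by (rule sum.swap)
  also have "\<dots> = (\<Sum>x\<in>carrier G. \<Sum>y\<in>carrier G. f1 x * (f2 y * f3 (inv y \<otimes> (inv x \<otimes> g))))"
  proof (rule sum.cong)
    fix x assume x: "x \<in> carrier G"
    have "(\<Sum>h\<in>carrier G. f1 x * f2 (inv x \<otimes> h) * f3 (inv h \<otimes> g))
        = (\<Sum>y\<in>carrier G. f1 x * f2 (inv x \<otimes> (x \<otimes> y)) * f3 (inv (x \<otimes> y) \<otimes> g))"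
      using x by (rule sum_carrier_left[symmetric])
    also have "\<dots> = (\<Sum>y\<in>carrier G. f1 x * (f2 y * f3 (inv y \<otimes> (inv x \<otimes> g))))"
      using x g by (intro sum.cong) (auto simp: inv_mult_cancel inv_mult_group m_assoc)
    finally show "(\<Sum>h\<in>carrier G. f1 x * f2 (inv x \<otimes> h) * f3 (inv h \<otimes> g)) = \<dots>" .
  qed simp
  also have "\<dots> = L_conv G f1 (L_conv G f2 f3) g"
    using g by (simp add: L_conv_apply sum_distrib_left)
  finally show "L_conv G (L_conv G f1 f2) f3 g = L_conv G f1 (L_conv G f2 f3) g" .
qed simp_all

lemma L_conv_add_left: "L_conv G (f1 + f2) f = L_conv G f1 f + L_conv G f2 f"
  by (auto simp: L_conv_def on_dom_def fun_eq_iff distrib_right sum.distrib)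

lemma L_conv_add_right: "L_conv G f (f1 + f2) = L_conv G f f1 + L_conv G f f2"
  by (auto simp: L_conv_def on_dom_def fun_eq_iff distrib_left sum.distrib)

lemma L_conv_scale_left: "L_conv G (L_scale c f1) f2 = L_scale c (L_conv G f1 f2)"
  by (auto simp: L_conv_def on_dom_def fun_eq_iff fun_scale_def sum_distrib_left mult_ac)

lemma L_conv_scale_right: "L_conv G f1 (L_scale c f2) = L_scale c (L_conv G f1 f2)"
  by (auto simp: L_conv_def on_dom_def fun_eq_iff fun_scale_def sum_distrib_left mult_ac)

lemma L_conv_zero_left [simp]: "L_conv G 0 f = 0"
  by (auto simp: L_conv_def on_dom_def fun_eq_iff)

lemma L_star_star: "f \<in> L G \<Longrightarrow> L_star G (L_star G f) = f"
  by (rule L_ext) (auto simp: L_star_apply)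

lemma L_star_add: "L_star G (f1 + f2) = L_star G f1 + L_star G f2"
  by (auto simp: L_star_def on_dom_def fun_eq_iff)

lemma L_star_scale: "L_star G (L_scale c f) = L_scale (cnj c) (L_star G f)"
  by (auto simp: L_star_def on_dom_def fun_eq_iff fun_scale_def)

lemma L_star_conv: "L_star G (L_conv G f1 f2) = L_conv G (L_star G f2) (L_star G f1)"
proof (rule L_ext)
  fix g assume g: "g \<in> carrier G"
  have "L_star G (L_conv G f1 f2) g = (\<Sum>h\<in>carrier G. cnj (f1 (inv g \<otimes> h)) * cnj (f2 (inv h)))"
    using g by (simp add: L_star_apply) (simp add: L_conv_def on_dom_def)
  also have "\<dots> = L_conv G (L_star G f2) (L_star G f1) g"
    using g by (auto simp: L_conv_apply L_star_apply inv_mult_group intro!: sum.cong)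
  finally show "L_star G (L_conv G f1 f2) g = L_conv G (L_star G f2) (L_star G f1) g" .
qed simp_all

lemma star_algebra_L: "star_algebra L_scale (L G) (L_conv G) (L_star G)"
proof -
  interpret vector_space "L_scale :: complex \<Rightarrow> ('a \<Rightarrow> complex) \<Rightarrow> _"
    by (rule vector_space_fun_scale[OF vector_space_mult])
  show ?thesis
    by unfold_locales
      (simp_all add: subspace_L L_conv_assoc L_conv_add_left L_conv_add_right L_conv_scale_left
        L_conv_scale_right L_star_star L_star_add L_star_scale L_star_conv)
qed

text \<open>The involution of the group algebra is the Hilbert space adjoint on right convolution
  operators. Hence a self-adjoint idempotent acts as an orthogonal projection, and \<open>op\<close>
  respects the involutions.\<close>

lemma L_ip_conv: "L_ip G (L_conv G f1 f) f2 = L_ip G f1 (L_conv G f2 (L_star G f))"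
proof -
  have "L_ip G (L_conv G f1 f) f2
      = (\<Sum>g\<in>carrier G. \<Sum>h\<in>carrier G. f1 h * f (inv h \<otimes> g) * cnj (f2 g))"
    by (simp add: L_ip_def L_conv_apply sum_distrib_right)
  also have "\<dots> = (\<Sum>h\<in>carrier G. \<Sum>g\<in>carrier G. f1 h * f (inv h \<otimes> g) * cnj (f2 g))"
    by (rule sum.swap)
  also have "\<dots> = L_ip G f1 (L_conv G f2 (L_star G f))"
    by (auto simp: L_ip_def L_conv_apply L_star_apply inv_mult_group sum_distrib_left mult_ac
        intro!: sum.cong)
  finally show ?thesis .
qed

text \<open>For self-adjoint p this makes f * p the family of frame coefficients of f against the
  translates of p.\<close>

lemma L_ip_ltrans:
  "h \<in> carrier G \<Longrightarrow> L_ip G f (ltrans G h p) = L_conv G f (L_star G p) h"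
  by (auto simp: L_ip_def L_conv_apply L_star_apply ltrans_apply inv_mult_group intro!: sum.cong)

text \<open>Traces of convolution operators come out as values at the identity; this turns such a
  value back into a scalar product.\<close>

lemma L_conv_star_one: "L_conv G f1 (L_star G f2) \<one> = L_ip G f1 f2"
  by (auto simp: L_ip_def L_conv_apply L_star_apply intro!: sum.cong)

lemma ltrans_L_conv:
  assumes x: "x \<in> carrier G"
  shows "ltrans G x (L_conv G f p) = L_conv G (ltrans G x f) p"
proof (rule L_ext)
  fix g assume g: "g \<in> carrier G"
  then show "ltrans G x (L_conv G f p) g = L_conv G (ltrans G x f) p g"
    using x by (simp add: ltrans_apply) (simp add: L_conv_def on_dom_def ltrans_apply m_assoc)
qed simp_all

lemma L_conv_expand: "L_conv G f p = (\<Sum>h\<in>carrier G. L_scale (f h) (ltrans G h p))"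
proof (rule ext)
  fix g
  show "L_conv G f p g = (\<Sum>h\<in>carrier G. L_scale (f h) (ltrans G h p)) g"
  proof (cases "g \<in> carrier G")
    case True
    then show ?thesis
      by (simp add: sum_fun_apply L_conv_apply ltrans_apply fun_scale_def)
  next
    case False
    then show ?thesis
      by (simp add: sum_fun_apply L_conv_outside ltrans_def on_dom_def fun_scale_def)
  qed
qed

lemma L_ip_self_eq_0:
  assumes "finite (carrier G)" "f \<in> L G" "L_ip G f f = 0"
  shows "f = 0"
proof -
  have "L_ip G f f = of_real (\<Sum>g\<in>carrier G. (cmod (f g))\<^sup>2)"
    by (simp only: L_ip_def complex_norm_square of_real_sum)
  then have "(\<Sum>g\<in>carrier G. (cmod (f g))\<^sup>2) = 0"
    unfolding assms(3) by (metis of_real_eq_0_iff)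
  then have "\<forall>g\<in>carrier G. f g = 0"
    using assms(1) by (subst (asm) sum_nonneg_eq_0_iff) auto
  then show ?thesis
    using assms(2) by (auto simp: L_def fun_eq_iff)
qed

end

section \<open>Self-adjoint idempotents p: the left ideal L(G) * p and its endomorphisms\<close>

locale group_algebra_projection = group G for G (structure) +
  fixes p :: "'a \<Rightarrow> complex"
  assumes finite_carrier: "finite (carrier G)"
    and p_in_L: "p \<in> L G"
    and p_idem: "L_conv G p p = p"
    and p_star: "L_star G p = p"
begin

text \<open>The left ideal L(G) * p and the corner p * L(G) * p, as fixed point sets. For p = \<psi>
  they become the spaces I(G,K,\<psi>) and H(G,K,\<psi>) of the theorem.\<close>

definition "PI = {f \<in> L G. L_conv G f p = f}"
definition "PH = {f \<in> L G. L_conv G (L_conv G p f) p = f}"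
definition "op f = on_dom PI (\<lambda>f'. L_conv G f' f)"

abbreviation "End_PI \<equiv> intertwiners (carrier G) L_scale PI (ltrans G) L_scale PI (ltrans G)"

sublocale Lsp: complex_vector_space "L_scale :: complex \<Rightarrow> ('a \<Rightarrow> complex) \<Rightarrow> _"
  by (intro complex_vector_space.intro vector_space_fun_scale vector_space_mult)

sublocale Opsp: complex_vector_space "fun_scale L_scale :: complex \<Rightarrow> (('a \<Rightarrow> complex) \<Rightarrow> ('a \<Rightarrow> complex)) \<Rightarrow> _"
  by (intro complex_vector_space.intro vector_space_fun_scale Lsp.vector_space_axioms)

lemma PI_L: "f \<in> PI \<Longrightarrow> f \<in> L G"
  by (simp add: PI_def)

lemma PI_conv_p: "f \<in> PI \<Longrightarrow> L_conv G f p = f"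
  by (simp add: PI_def)

lemma conv_p_in_PI [simp]: "L_conv G f p \<in> PI"
  by (simp add: PI_def L_conv_assoc p_idem)

lemma PI_eq_range: "PI = {L_conv G f p |f. f \<in> L G}"
  by (auto simp: PI_def L_conv_assoc p_idem) metis

lemma subspace_PI: "Lsp.subspace PI"
  using Lsp.subspace_0[OF subspace_L] Lsp.subspace_add[OF subspace_L]
    Lsp.subspace_scale[OF subspace_L]
  by (intro Lsp.subspaceI) (auto simp: PI_def L_conv_add_left L_conv_scale_left)

text \<open>Multiplying p * f * p = f by p on either side splits the condition into two one-sided
  ones, the form in which it is applied later.\<close>

lemma PH_iff: "f \<in> PH \<longleftrightarrow> f \<in> L G \<and> L_conv G p f = f \<and> L_conv G f p = f"
  unfolding PH_def by auto (metis L_conv_assoc p_idem)+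

lemma PH_PI: "f \<in> PH \<Longrightarrow> f \<in> PI"
  by (simp add: PH_iff PI_def)

lemma p_in_PI: "p \<in> PI"
  by (simp add: PI_def p_in_L p_idem)

lemma ltrans_in_PI: "x \<in> carrier G \<Longrightarrow> f \<in> PI \<Longrightarrow> ltrans G x f \<in> PI"
  by (simp add: PI_def ltrans_L_conv[symmetric])

lemma conv_PH_in_PI: "f \<in> PH \<Longrightarrow> L_conv G f' f \<in> PI"
  by (simp add: PI_def PH_iff L_conv_assoc)

lemma Hpsi_eq_PH: "Hpsi G p = PH"
proof
  show "Hpsi G p \<subseteq> PH"
    by (auto simp: Hpsi_def PH_iff) (simp_all only: L_conv_assoc[symmetric] p_idem,
        simp_all only: L_conv_assoc p_idem)
  show "PH \<subseteq> Hpsi G p"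
    by (force simp: Hpsi_def PH_def)
qed

lemma orthogonal_projection_PI:
  "orthogonal_projection L_scale (L_ip G) (L G) PI (\<lambda>f. L_conv G f p)"
  unfolding orthogonal_projection_def
proof (intro conjI ballI)
  show "on_dom (L G) (\<lambda>f. L_conv G f p) \<in> lin_maps L_scale (L G) L_scale (L G)"
    using Lsp.subspace_add[OF subspace_L] Lsp.subspace_scale[OF subspace_L]
    by (auto simp: lin_maps_def on_dom_def L_conv_add_left L_conv_scale_left)
  show "(\<lambda>f. L_conv G f p) ` L G = PI"
    by (auto simp: PI_eq_range)
  show "L_conv G (L_conv G f p) p = L_conv G f p" for f
    by (simp add: L_conv_assoc p_idem)
  fix f u assume "f \<in> L G" "u \<in> PI"
  have "L_ip G (f - L_conv G f p) u = L_ip G f u - L_ip G (L_conv G f p) u"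
    by (simp add: L_ip_def left_diff_distrib sum_subtractf)
  moreover have "L_ip G (L_conv G f p) u = L_ip G f u"
    using \<open>u \<in> PI\<close> by (simp add: L_ip_conv p_star PI_conv_p)
  ultimately show "L_ip G (f - L_conv G f p) u = 0" by simp
qed

text \<open>Since f = p * f, it suffices that f' * p = 0, and the values of f' * p are inner
  products of f' with translates of p, all of which lie in \<open>PI\<close>.\<close>

lemma conv_orthogonal:
  assumes "f \<in> PH" "\<And>u. u \<in> PI \<Longrightarrow> L_ip G f' u = 0"
  shows "L_conv G f' f = 0"
proof -
  have "L_conv G f' p = 0"
  proof
    fix g
    show "L_conv G f' p g = 0 g"
      using assms(2)[OF ltrans_in_PI[OF _ p_in_PI], of g] L_ip_ltrans[of g f' p] p_star
      by (cases "g \<in> carrier G") (auto simp: L_conv_outside)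
  qed
  then have "L_conv G f' (L_conv G p f) = 0"
    by (simp add: L_conv_assoc[symmetric])
  then show ?thesis using assms(1) by (simp add: PH_iff)
qed

lemma subspace_PH: "Lsp.subspace PH"
  using Lsp.subspace_0[OF subspace_L] Lsp.subspace_add[OF subspace_L]
    Lsp.subspace_scale[OF subspace_L] L_conv_scale_right[of p 0 p]
  by (intro Lsp.subspaceI)
    (auto simp: PH_iff L_conv_add_left L_conv_scale_left L_conv_add_right L_conv_scale_right)

lemma conv_in_PH: "f1 \<in> PH \<Longrightarrow> f2 \<in> PH \<Longrightarrow> L_conv G f1 f2 \<in> PH"
  by (auto simp: PH_iff L_conv_assoc) (simp add: L_conv_assoc[symmetric])

lemma star_in_PH: "f \<in> PH \<Longrightarrow> L_star G f \<in> PH"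
  unfolding PH_iff using p_star by (metis L_star_conv L_star_in_L)

lemma star_algebra_PH: "star_algebra L_scale PH (L_conv G) (L_star G)"
  by unfold_locales
    (simp_all add: subspace_PH conv_in_PH star_in_PH L_conv_assoc L_conv_add_left L_conv_add_right
      L_conv_scale_left L_conv_scale_right L_star_star L_star_add L_star_scale L_star_conv PI_L[OF PH_PI])

lemma op_apply: "f' \<in> PI \<Longrightarrow> op f f' = L_conv G f' f"
  by (simp add: op_def on_dom_def)

lemma op_in_End: "f \<in> PH \<Longrightarrow> op f \<in> End_PI"
  using Lsp.subspace_add[OF subspace_PI] Lsp.subspace_scale[OF subspace_PI]
  by (auto simp: intertwiners_def lin_maps_def op_apply conv_PH_in_PI L_conv_add_left
      L_conv_scale_left ltrans_in_PI ltrans_L_conv) (simp add: op_def on_dom_def)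

text \<open>An intertwiner \<open>U\<close> is determined by \<open>U p\<close>, because every \<open>f \<in> PI\<close> equals \<open>f * p\<close> and is
  thus a combination of translates of \<open>p\<close>.\<close>

lemma End_apply:
  assumes U: "U \<in> End_PI" and f: "f \<in> PI"
  shows "U f = L_conv G f (U p)"
proof -
  have "U f = U (\<Sum>h\<in>carrier G. L_scale (f h) (ltrans G h p))"
    using PI_conv_p[OF f] L_conv_expand[of f p] by simp
  also have "\<dots> = (\<Sum>h\<in>carrier G. L_scale (f h) (U (ltrans G h p)))"
    using U by (intro Lsp.lin_maps_sum[OF _ subspace_PI Lsp.vector_space_axioms])
      (auto simp: intertwiners_def ltrans_in_PI p_in_PI)
  also have "\<dots> = (\<Sum>h\<in>carrier G. L_scale (f h) (ltrans G h (U p)))"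
    using U p_in_PI by (auto simp: intertwiners_def intro!: sum.cong)
  finally show ?thesis by (simp add: L_conv_expand)
qed

lemma End_p_in_PH:
  assumes U: "U \<in> End_PI"
  shows "U p \<in> PH"
proof -
  have "U p \<in> PI" using U p_in_PI by (auto simp: intertwiners_def lin_maps_def)
  moreover have "L_conv G p (U p) = U p" using End_apply[OF U p_in_PI] by simp
  ultimately show ?thesis by (simp add: PH_iff PI_def)
qed

lemma op_End_p: "U \<in> End_PI \<Longrightarrow> op (U p) = U"
  by (auto simp: fun_eq_iff op_def on_dom_def End_apply[symmetric] intertwiners_def lin_maps_def)

lemma op_p: "f \<in> PH \<Longrightarrow> op f p = f"
  by (simp add: op_apply p_in_PI PH_iff)

lemma bij_betw_op: "bij_betw op PH End_PI"
  by (rule bij_betw_byWitness[where f' = "\<lambda>U. U p"])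
    (auto simp: op_p op_End_p op_in_End End_p_in_PH)

lemma adjoint_op:
  assumes f: "f \<in> PH"
  shows "adjoint_on L_scale (L_ip G) PI (op f) = op (L_star G f)"
proof (rule adjoint_on_eq[OF Lsp.vector_space_axioms subspace_PI])
  show "op (L_star G f) \<in> lin_maps L_scale PI L_scale PI"
    using op_in_End[OF star_in_PH[OF f]] by (simp add: intertwiners_def)
qed (auto simp: L_ip_def distrib_left sum.distrib op_apply L_ip_conv[unfolded L_ip_def]
    intro: L_ip_self_eq_0[OF finite_carrier PI_L, unfolded L_ip_def])

lemma op_conv: "f1 \<in> PH \<Longrightarrow> f2 \<in> PH \<Longrightarrow> op (L_conv G f1 f2) = op f2 \<circ> op f1"
  \<comment> \<open>Off \<open>PI\<close> both sides vanish: \<open>op f1\<close> is 0 there, and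
    \<open>op f2\<close> maps 0, an element of \<open>PI\<close>, to 0 * f2 = 0.\<close>
  using Lsp.subspace_0[OF subspace_PI]
  by (auto simp: fun_eq_iff op_def on_dom_def conv_PH_in_PI L_conv_assoc)

lemma subspace_End: "Opsp.subspace End_PI"
proof (rule Opsp.subspaceI)
  note PI_simps = Lsp.subspace_0[OF subspace_PI] Lsp.subspace_add[OF subspace_PI]
    Lsp.subspace_scale[OF subspace_PI]
  have *: "ltrans G h (f1 + f2) = ltrans G h f1 + ltrans G h f2"
    "ltrans G h (L_scale c f1) = L_scale c (ltrans G h f1)"
    "ltrans G h (0::'a \<Rightarrow> complex) = 0" for h c and f1 f2 :: "'a \<Rightarrow> complex"
    by (auto simp: ltrans_def on_dom_def fun_scale_def fun_eq_iff)
  show "0 \<in> End_PI"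
    by (auto simp: intertwiners_def lin_maps_def PI_simps *)
  show "U1 + U2 \<in> End_PI" if "U1 \<in> End_PI" "U2 \<in> End_PI" for U1 U2
    using that by (auto simp: intertwiners_def lin_maps_def PI_simps * Lsp.scale_right_distrib)
  show "fun_scale L_scale c U \<in> End_PI" if "U \<in> End_PI" for c U
    using that by (auto simp: intertwiners_def lin_maps_def PI_simps *
        Lsp.scale_right_distrib Lsp.scale_left_commute fun_scale_def[of L_scale])
qed

lemma comp_in_End: "U1 \<in> End_PI \<Longrightarrow> U2 \<in> End_PI \<Longrightarrow> U1 \<circ> U2 \<in> End_PI"
  by (metis op_End_p End_p_in_PH op_conv conv_in_PH op_in_End)

lemma adjoint_End:
  assumes "U \<in> End_PI"
  shows "adjoint_on L_scale (L_ip G) PI U = op (L_star G (U p))"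
  using adjoint_op[OF End_p_in_PH[OF assms]] op_End_p[OF assms] by simp

lemma star_algebra_End: "star_algebra (fun_scale L_scale) End_PI (\<circ>) (adjoint_on L_scale (L_ip G) PI)"
proof (rule star_algebra_pullback[OF star_algebra_PH Opsp.vector_space_axioms subspace_End,
      where \<phi> = "\<lambda>U. U p"])
  show "inj_on (\<lambda>U. U p) End_PI"
    by (rule inj_on_inverseI[where g = op]) (rule op_End_p)
  fix U1 U2 assume "U1 \<in> End_PI" "U2 \<in> End_PI"
  then show "(U1 \<circ> U2) p = L_conv G (U2 p) (U1 p)"
    using End_apply[of U1 "U2 p"] End_p_in_PH PH_PI by auto
next
  fix U assume "U \<in> End_PI"
  then show "adjoint_on L_scale (L_ip G) PI U \<in> End_PI"
    "adjoint_on L_scale (L_ip G) PI U p = L_star G (U p)"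
    by (simp_all add: adjoint_End op_in_End star_in_PH End_p_in_PH op_p)
qed (simp_all add: End_p_in_PH comp_in_End fun_scale_def)

lemma star_anti_isomorphism_op:
  "star_anti_isomorphism L_scale PH (L_conv G) (L_star G) (fun_scale L_scale) End_PI (\<circ>)
    (adjoint_on L_scale (L_ip G) PI) op"
  unfolding star_anti_isomorphism_def
proof (intro conjI allI ballI star_algebra_PH star_algebra_End bij_betw_op)
  show "op (f1 + f2) = op f1 + op f2" for f1 f2
    by (auto simp: fun_eq_iff op_def on_dom_def L_conv_add_right)
  show "op (L_scale c f) = fun_scale L_scale c (op f)" for c f
    by (rule ext) (simp add: fun_scale_def[of L_scale] op_def on_dom_def L_conv_scale_right)
qed (simp_all add: op_conv adjoint_op)

text \<open>The translates of \<open>p\<close> form a Parseval frame of \<open>PI\<close>.\<close>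

lemma trace_op:
  assumes f: "f \<in> PH"
  shows "trace_on L_scale PI (op f) = of_nat (card (carrier G)) * f \<one>"
proof -
  have "trace_on L_scale PI (op f) = (\<Sum>g\<in>carrier G. (op f (ltrans G g p)) g)"
  proof (rule Lsp.trace_on_frame[OF subspace_PI])
    show "f' = (\<Sum>h\<in>carrier G. L_scale (f' h) (ltrans G h p))" if "f' \<in> PI" for f'
      using PI_conv_p[OF that] L_conv_expand[of f' p] by simp
    show "on_dom PI (\<lambda>f'. f' g) \<in> lin_maps L_scale PI (*) UNIV" for g
      using Lsp.subspace_add[OF subspace_PI] Lsp.subspace_scale[OF subspace_PI]
      by (auto simp: lin_maps_def on_dom_def fun_scale_def)
    show "op f \<in> lin_maps L_scale PI L_scale PI"
      using op_in_End[OF f] by (simp add: intertwiners_def)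
  qed (use finite_carrier ltrans_in_PI p_in_PI in auto)
  also have "\<dots> = (\<Sum>g\<in>carrier G. f \<one>)"
  proof (rule sum.cong)
    fix g assume g: "g \<in> carrier G"
    \<comment> \<open>Translation commutes with right convolution, so each diagonal entry is the
      value of p * f = f at g^-1 g = 1.\<close>
    have "op f (ltrans G g p) = ltrans G g (L_conv G p f)"
      using g by (simp add: op_apply ltrans_in_PI p_in_PI ltrans_L_conv)
    then show "op f (ltrans G g p) g = f \<one>"
      using f g by (simp add: PH_iff ltrans_apply)
  qed simp
  finally show ?thesis by simp
qed

text \<open>The adjoint of \<open>op f2\<close> composed with \<open>op f1\<close> is right
  convolution by f1 * \<open>L_star G f2\<close>. Its trace is |G| times the value of that function
  at the identity, which is \<open>L_ip G f1 f2\<close>.\<close>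

lemma End_ip_op:
  assumes "f1 \<in> PH" "f2 \<in> PH"
  shows "End_ip L_scale (L_ip G) PI (op f1) (op f2)
    = of_nat (card (carrier G)) / of_nat (Lsp.dim PI) * L_ip G f1 f2"
  using assms
  by (simp add: End_ip_def adjoint_op op_conv[symmetric] star_in_PH trace_op conv_in_PH
      L_conv_star_one)

end

section \<open>Induction from a subgroup\<close>

locale induced_rep = group G + fd_inner_product_space scale ip
  for G :: "('g, 'm) monoid_scheme" (structure)
    and scale :: "complex \<Rightarrow> 'v::ab_group_add \<Rightarrow> 'v" and ip +
  fixes K :: "'g set" and \<theta> :: "'g \<Rightarrow> 'v \<Rightarrow> 'v" and v :: 'v and b :: "nat \<Rightarrow> 'v"
  assumes finite_carrier: "finite (carrier G)"
    and subgroup_K: "subgroup K G"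
    and unitary: "unitary_rep G K scale ip \<theta>"
    and irreducible: "irreducible_rep K scale \<theta>"
    and norm_v: "ip_norm ip v = 1"
    and orthonormal: "\<And>i j. i \<in> {1..dim UNIV} \<Longrightarrow> j \<in> {1..dim UNIV} \<Longrightarrow>
      ip (b i) (b j) = (if i = j then 1 else 0)"
    and span_b: "span (b ` {1..dim UNIV}) = UNIV"
begin

abbreviation "d \<equiv> dim UNIV"
abbreviation "\<psi> \<equiv> psi K scale ip \<theta> v"
abbreviation "T \<equiv> Tv K scale ip v"
abbreviation "Sm \<equiv> Sv scale ip v"
abbreviation "IndV \<equiv> Ind G K \<theta>"
abbreviation "HTil \<equiv> HT G K scale \<theta>"
abbreviation "adj \<equiv> adjoint_on scale ip UNIV"

text \<open>\<open>q\<close> is the frame bound of the orbit of v: the frame operator has trace |K|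
  and is a scalar on a space of dimension d. The constant \<open>c\<close> is q^(-1/2), so that c^2
  cancels the \<open>q\<close> produced by \<open>orbit_parseval\<close> in the isometry of
  T.\<close>

definition q :: complex where "q = of_nat (card K) / of_nat d"
definition c :: complex where "c = complex_of_real (sqrt (real d / real (card K)))"

lemma K_carrier: "k \<in> K \<Longrightarrow> k \<in> carrier G"
  by (rule subgroup.mem_carrier[OF subgroup_K])

lemma K_mult: "k \<in> K \<Longrightarrow> l \<in> K \<Longrightarrow> k \<otimes> l \<in> K"
  by (rule subgroup.m_closed[OF subgroup_K])

lemma K_inv: "k \<in> K \<Longrightarrow> inv k \<in> K"
  by (rule subgroup.m_inv_closed[OF subgroup_K])

lemma K_one: "\<one> \<in> K"
  by (rule subgroup.one_closed[OF subgroup_K])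

lemma finite_K: "finite K"
  using finite_carrier K_carrier by (meson finite_subset subsetI)

lemma card_K: "card K > 0"
  using finite_K K_one by (auto simp: card_gt_0_iff)

lemma d_pos: "d > 0"
proof (rule ccontr)
  assume "\<not> d > 0"
  then have "(UNIV :: 'v set) = {0}" using span_b by simp
  then show False using irreducible by (simp add: irreducible_rep_def)
qed

lemma q_nonzero: "q \<noteq> 0"
  using card_K d_pos by (simp add: q_def)

lemma c_nonzero: "c \<noteq> 0"
  using card_K d_pos by (simp add: c_def)

lemma c_square: "c * c = 1 / q"
  by (simp add: c_def q_def of_real_mult[symmetric] del: of_real_mult)

lemma cnj_c: "cnj c = c"
  by (simp add: c_def)

lemma \<theta>_linear: "k \<in> K \<Longrightarrow> Vector_Spaces.linear scale scale (\<theta> k)"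
  using unitary by (simp add: unitary_rep_def)

lemma \<theta>_sum: "k \<in> K \<Longrightarrow> \<theta> k (\<Sum>a\<in>A. f a) = (\<Sum>a\<in>A. \<theta> k (f a))"
  using \<theta>_linear[of k] by (simp add: linear_iff_module_hom module_hom.sum)

lemma \<theta>_scale: "k \<in> K \<Longrightarrow> \<theta> k (scale z u) = scale z (\<theta> k u)"
  using \<theta>_linear[of k] by (simp add: linear_iff_module_hom module_hom.scale)

lemma \<theta>_add: "k \<in> K \<Longrightarrow> \<theta> k (u + w) = \<theta> k u + \<theta> k w"
  using \<theta>_linear[of k] by (simp add: linear_iff_module_hom module_hom.add)

lemma \<theta>_zero: "k \<in> K \<Longrightarrow> \<theta> k 0 = 0"
  using \<theta>_scale[of k 0 0] by simp

lemma \<theta>_one: "\<theta> \<one> u = u"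
  using unitary by (simp add: unitary_rep_def)

lemma \<theta>_mult: "k \<in> K \<Longrightarrow> l \<in> K \<Longrightarrow> \<theta> (k \<otimes> l) u = \<theta> k (\<theta> l u)"
  using unitary by (simp add: unitary_rep_def)

lemma \<theta>_inv_left: "k \<in> K \<Longrightarrow> \<theta> (inv k) (\<theta> k u) = u"
  by (simp add: \<theta>_mult[symmetric] K_inv K_carrier \<theta>_one)

lemma \<theta>_unitary: "k \<in> K \<Longrightarrow> ip (\<theta> k u) (\<theta> k w) = ip u w"
  using unitary by (simp add: unitary_rep_def)

lemma \<theta>_ip: "k \<in> K \<Longrightarrow> ip (\<theta> (inv k) u) w = ip u (\<theta> k w)"
  using \<theta>_unitary[of "inv k" u "\<theta> k w"] by (simp add: \<theta>_inv_left K_inv)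

lemma \<theta>_ip_inv: "k \<in> K \<Longrightarrow> ip u (\<theta> (inv k) w) = ip (\<theta> k u) w"
  using \<theta>_ip[of "inv k" u w] by (simp add: K_inv K_carrier)

section \<open>The orbit of v as a tight frame, and averages over K\<close>

lemma ip_v: "ip v v = 1"
proof -
  have "Re (ip v v) = 1" using norm_v by (simp add: ip_norm_def)
  moreover have "Im (ip v v) = 0" using ip_commute[of v v] by (metis cnj.simps(2) equal_neg_zero)
  ultimately show ?thesis by (simp add: complex_eq_iff)
qed

lemma basis_expansion: "u = (\<Sum>i\<in>{1..d}. scale (ip u (b i)) (b i))"
proof -
  have "u \<in> span (b ` {1..d})" by (simp only: span_b UNIV_I)
  then show ?thesis
  proof (induction rule: span_induct_alt)
    case (step z x y)
    then obtain j where j: "j \<in> {1..d}" "x = b j" by auto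
    have "(\<Sum>i\<in>{1..d}. scale (ip x (b i)) (b i)) = (\<Sum>i\<in>{1..d}. if j = i then b i else 0)"
      using j by (intro sum.cong) (auto simp: orthonormal)
    also have "\<dots> = x" using j by simp
    finally have x: "(\<Sum>i\<in>{1..d}. scale (ip x (b i)) (b i)) = x" .
    have "(\<Sum>i\<in>{1..d}. scale (ip (scale z x + y) (b i)) (b i))
        = scale z (\<Sum>i\<in>{1..d}. scale (ip x (b i)) (b i)) + (\<Sum>i\<in>{1..d}. scale (ip y (b i)) (b i))"
      by (simp add: ip_add_left ip_scale_left scale_left_distrib sum.distrib scale_sum_right)
    then show ?case using x step by simp
  qed simp
qed

lemma ip_basis: "(\<Sum>i\<in>{1..d}. ip u (b i) * ip (b i) w) = ip u w"
proof -
  have "ip u w = ip (\<Sum>i\<in>{1..d}. scale (ip u (b i)) (b i)) w"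
    using basis_expansion[of u] by simp
  then show ?thesis by (simp add: ip_sum_left ip_scale_left)
qed

text \<open>Schur's lemma for the frame operator of the orbit of \<open>v\<close>; its eigenvalue is found by
  taking the trace.\<close>

lemma orbit_frame: "(\<Sum>k\<in>K. scale (ip u (\<theta> k v)) (\<theta> k v)) = scale q u"
proof -
  define A where "A u = (\<Sum>k\<in>K. scale (ip u (\<theta> k v)) (\<theta> k v))" for u
  have A_add: "A (x + y) = A x + A y" for x y
    by (simp add: A_def ip_add_left scale_left_distrib sum.distrib)
  have A_scale: "A (scale z x) = scale z (A x)" for z x
    by (simp add: A_def ip_scale_left scale_sum_right)
  have "Vector_Spaces.linear scale scale A"
    by (simp add: linear_iff_module_hom module_hom_iff module_axioms A_add A_scale)
  then obtain z y where y: "y \<noteq> 0" "A y = scale z y"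
  proof -
    obtain x :: 'v where "x \<noteq> 0" using irreducible by (auto simp: irreducible_rep_def)
    moreover have "\<exists>z. poly p z = 0" if "degree p > 0" for p :: "complex poly"
      using that by (intro fundamental_theorem_of_algebra_alt) auto
    ultimately show ?thesis
      using eigenvector_exists[OF \<open>Vector_Spaces.linear scale scale A\<close>] finite_dim that by blast
  qed
  have A_\<theta>: "A (\<theta> l u) = \<theta> l (A u)" if l: "l \<in> K" for l u
  proof -
    have "A (\<theta> l u) = (\<Sum>k\<in>K. scale (ip (\<theta> l u) (\<theta> (l \<otimes> k) v)) (\<theta> (l \<otimes> k) v))"
      unfolding A_def using sum_subgroup_left[OF subgroup_K l] by (rule sym)
    also have "\<dots> = \<theta> l (A u)"
      using l by (simp add: A_def \<theta>_sum \<theta>_scale \<theta>_mult \<theta>_unitary)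
    finally show ?thesis .
  qed
  let ?W = "{u. A u = scale z u}"
  have "subspace ?W"
    using A_scale[of 0 0] by (intro subspaceI) (auto simp: A_add A_scale scale_right_distrib mult.commute)
  moreover have "\<forall>k\<in>K. \<theta> k ` ?W \<subseteq> ?W"
    by (auto simp: A_\<theta> \<theta>_scale)
  ultimately have "?W = {0} \<or> ?W = UNIV"
    using irreducible by (simp add: irreducible_rep_def)
  then have A: "A u = scale z u" for u using y by auto
  have "z * of_nat d = (\<Sum>i\<in>{1..d}. ip (A (b i)) (b i))"
    using orthonormal by (simp add: A ip_scale_left)
  also have "\<dots> = (\<Sum>i\<in>{1..d}. \<Sum>k\<in>K. ip (\<theta> k v) (b i) * ip (b i) (\<theta> k v))"
    by (simp add: A_def ip_sum_left ip_scale_left mult.commute)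
  also have "\<dots> = (\<Sum>k\<in>K. \<Sum>i\<in>{1..d}. ip (\<theta> k v) (b i) * ip (b i) (\<theta> k v))"
    by (rule sum.swap)
  also have "\<dots> = of_nat (card K)"
    by (simp only: ip_basis) (simp add: \<theta>_unitary ip_v)
  finally have "z = q"
    using d_pos by (simp add: q_def field_simps)
  with A[of u] show ?thesis by (simp add: A_def)
qed

lemma orbit_parseval: "(\<Sum>k\<in>K. ip u (\<theta> k v) * ip (\<theta> k v) w) = q * ip u w"
proof -
  have "(\<Sum>k\<in>K. ip u (\<theta> k v) * ip (\<theta> k v) w) = ip (\<Sum>k\<in>K. scale (ip u (\<theta> k v)) (\<theta> k v)) w"
    by (simp add: ip_sum_left ip_scale_left)
  then show ?thesis by (simp add: orbit_frame ip_scale_left)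
qed

text \<open>A applied to the frame expansion of u. Here A will be a value F(g) of a Hecke algebra
  element.\<close>

lemma linear_orbit:
  assumes "Vector_Spaces.linear scale scale A"
  shows "(\<Sum>k\<in>K. ip u (\<theta> k v) * ip (A (\<theta> k v)) w) = q * ip (A u) w"
proof -
  interpret A: Vector_Spaces.linear scale scale A by fact
  have "(\<Sum>k\<in>K. ip u (\<theta> k v) * ip (A (\<theta> k v)) w)
      = ip (A (\<Sum>k\<in>K. scale (ip u (\<theta> k v)) (\<theta> k v))) w"
    by (simp add: A.sum A.scale ip_sum_left ip_scale_left)
  then show ?thesis by (simp add: orbit_frame A.scale ip_scale_left)
qed

lemma sum_average_right:
  fixes f :: "'g \<Rightarrow> complex"
  shows "(\<Sum>g\<in>carrier G. f g) = 1 / of_nat (card K) * (\<Sum>g\<in>carrier G. \<Sum>k\<in>K. f (g \<otimes> k))"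
proof -
  have "(\<Sum>g\<in>carrier G. \<Sum>k\<in>K. f (g \<otimes> k)) = (\<Sum>k\<in>K. \<Sum>g\<in>carrier G. f (g \<otimes> k))"
    by (rule sum.swap)
  also have "\<dots> = of_nat (card K) * (\<Sum>g\<in>carrier G. f g)"
    by (simp add: sum_carrier_right K_carrier)
  finally show ?thesis using card_K by simp
qed

text \<open>The inverse is there because F(k^-1 g) = F(g) \<theta>(k), which again produces points
  of the orbit of v.\<close>

lemma sum_average_left:
  fixes f :: "'g \<Rightarrow> complex"
  shows "(\<Sum>g\<in>carrier G. f g) = 1 / of_nat (card K) * (\<Sum>g\<in>carrier G. \<Sum>k\<in>K. f (inv k \<otimes> g))"
proof -
  have "(\<Sum>g\<in>carrier G. \<Sum>k\<in>K. f (inv k \<otimes> g)) = (\<Sum>k\<in>K. \<Sum>g\<in>carrier G. f (inv k \<otimes> g))"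
    by (rule sum.swap)
  also have "\<dots> = of_nat (card K) * (\<Sum>g\<in>carrier G. f g)"
    by (simp add: sum_carrier_left K_carrier)
  finally show ?thesis using card_K by simp
qed

subsection \<open>The idempotent\<close>

lemma \<psi>_apply: "k \<in> K \<Longrightarrow> \<psi> k = 1 / q * ip v (\<theta> k v)"
  by (simp add: psi_def on_dom_def q_def)

lemma \<psi>_outside: "k \<notin> K \<Longrightarrow> \<psi> k = 0"
  by (simp add: psi_def on_dom_def)

lemma \<psi>_inv: "k \<in> K \<Longrightarrow> \<psi> (inv k) = 1 / q * ip (\<theta> k v) v"
  by (simp add: \<psi>_apply K_inv \<theta>_ip_inv)

lemma \<psi>_in_L: "\<psi> \<in> L G"
  unfolding L_def using K_carrier \<psi>_outside by blast

lemma K_inv_iff: "g \<in> carrier G \<Longrightarrow> inv g \<in> K \<longleftrightarrow> g \<in> K"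
  using K_inv by force

lemma conv_\<psi>:
  assumes g: "g \<in> carrier G"
  shows "L_conv G f \<psi> g = 1 / q * (\<Sum>k\<in>K. f (g \<otimes> k) * ip (\<theta> k v) v)"
proof -
  have "L_conv G f \<psi> g = (\<Sum>h\<in>carrier G. f (g \<otimes> h) * \<psi> (inv h))"
    using g by (simp add: L_conv_def on_dom_def)
  also have "\<dots> = (\<Sum>k\<in>K. f (g \<otimes> k) * \<psi> (inv k))"
    using finite_carrier by (intro sum.mono_neutral_right)
      (auto simp: K_carrier \<psi>_outside K_inv_iff)
  finally show ?thesis
    by (simp add: \<psi>_inv sum_distrib_left mult_ac cong: sum.cong)
qed

lemma \<psi>_conv:
  assumes g: "g \<in> carrier G"
  shows "L_conv G \<psi> f g = 1 / q * (\<Sum>k\<in>K. ip v (\<theta> k v) * f (inv k \<otimes> g))"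
proof -
  have "L_conv G \<psi> f g = (\<Sum>k\<in>K. \<psi> k * f (inv k \<otimes> g))"
    unfolding L_conv_apply[OF g]
    using finite_carrier by (intro sum.mono_neutral_right) (auto simp: K_carrier \<psi>_outside)
  then show ?thesis
    by (simp add: \<psi>_apply sum_distrib_left mult_ac cong: sum.cong)
qed

lemma K_mult_iff:
  assumes "g \<in> carrier G" "k \<in> K"
  shows "g \<otimes> k \<in> K \<longleftrightarrow> g \<in> K"
proof
  assume "g \<otimes> k \<in> K"
  then have "(g \<otimes> k) \<otimes> inv k \<in> K" using assms by (simp add: K_mult[OF _ K_inv])
  then show "g \<in> K" using assms K_carrier by (simp add: m_assoc)
qed (use assms K_mult in auto)

lemma \<psi>_idem: "L_conv G \<psi> \<psi> = \<psi>"
proof (rule L_ext)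
  fix g assume g: "g \<in> carrier G"
  show "L_conv G \<psi> \<psi> g = \<psi> g"
  proof (cases "g \<in> K")
    case True
    \<comment> \<open>Moving g to the other slot, <v, \<theta>(gk) v> = <\<theta>(g^-1) v,
      \<theta>(k) v>, makes this a Parseval sum, whose value \<open>q\<close> cancels one of the two
      factors 1/q.\<close>
    have "L_conv G \<psi> \<psi> g = 1 / q * (\<Sum>k\<in>K. 1 / q * (ip (\<theta> (inv g) v) (\<theta> k v) * ip (\<theta> k v) v))"
      using g True by (simp add: conv_\<psi> \<psi>_apply K_mult \<theta>_mult \<theta>_ip cong: sum.cong)
    also have "\<dots> = \<psi> g"
      using True q_nonzero
      by (simp only: sum_distrib_left[symmetric] orbit_parseval) (simp add: \<theta>_ip \<psi>_apply)
    finally show ?thesis .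
  qed (use g in \<open>simp add: conv_\<psi> \<psi>_outside K_mult_iff\<close>)
qed (simp_all add: \<psi>_in_L)

lemma cnj_q: "cnj q = q"
  by (simp add: q_def)

lemma \<psi>_star: "L_star G \<psi> = \<psi>"
proof (rule L_ext)
  fix g assume g: "g \<in> carrier G"
  show "L_star G \<psi> g = \<psi> g"
    using g ip_commute[of v "\<theta> g v"]
    by (cases "g \<in> K") (auto simp: L_star_apply \<psi>_inv \<psi>_apply \<psi>_outside K_inv_iff cnj_q \<theta>_ip_inv)
qed (simp_all add: \<psi>_in_L)

sublocale P: group_algebra_projection G \<psi>
  by unfold_locales (simp_all add: finite_carrier \<psi>_in_L \<psi>_idem \<psi>_star)

subsection \<open>The isometry into the group algebra\<close>

lemma T_apply: "T f g = c * ip (f g) v"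
  by (simp add: Tv_def c_def)

lemma Ind_right: "f \<in> IndV \<Longrightarrow> g \<in> carrier G \<Longrightarrow> k \<in> K \<Longrightarrow> f (g \<otimes> k) = \<theta> (inv k) (f g)"
  by (simp add: Ind_def)

lemma Ind_outside: "f \<in> IndV \<Longrightarrow> g \<notin> carrier G \<Longrightarrow> f g = 0"
  by (simp add: Ind_def)

sublocale Fsp: complex_vector_space "fun_scale scale :: complex \<Rightarrow> ('g \<Rightarrow> 'v) \<Rightarrow> _"
  by (intro complex_vector_space.intro vector_space_fun_scale vector_space_axioms)

lemma subspace_Ind: "Fsp.subspace IndV"
  by (intro Fsp.subspaceI)
    (auto simp: Ind_def fun_scale_def \<theta>_zero \<theta>_add \<theta>_scale K_inv)

lemma ltrans_in_Ind: "x \<in> carrier G \<Longrightarrow> f \<in> IndV \<Longrightarrow> ltrans G x f \<in> IndV"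
  by (auto simp: Ind_def ltrans_def on_dom_def K_carrier m_assoc[symmetric])

lemma T_in_L: "f \<in> IndV \<Longrightarrow> T f \<in> L G"
  by (simp add: L_def T_apply Ind_outside)

lemma T_add: "T (f1 + f2) = T f1 + T f2"
  by (simp add: fun_eq_iff T_apply ip_add_left distrib_left)

lemma T_scale: "T (fun_scale scale z f) = L_scale z (T f)"
  by (simp add: fun_eq_iff T_apply fun_scale_def ip_scale_left)

lemma T_ltrans: "T (ltrans G x f) = ltrans G x (T f)"
  by (simp add: fun_eq_iff T_apply ltrans_def on_dom_def)

text \<open>Convolution with \<psi> sums the frame coefficients of f(g) against those of v, and
  Parseval returns <f(g), v>.\<close>

lemma T_in_PI:
  assumes f: "f \<in> IndV"
  shows "T f \<in> P.PI"
proof -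
  have "L_conv G (T f) \<psi> = T f"
  proof (rule L_ext)
    fix g assume g: "g \<in> carrier G"
    have "L_conv G (T f) \<psi> g = 1 / q * (\<Sum>k\<in>K. c * (ip (f g) (\<theta> k v) * ip (\<theta> k v) v))"
      using f g by (simp add: conv_\<psi> T_apply Ind_right \<theta>_ip mult.assoc cong: sum.cong)
    also have "\<dots> = T f g"
      using q_nonzero by (simp only: sum_distrib_left[symmetric] orbit_parseval) (simp add: T_apply)
    finally show "L_conv G (T f) \<psi> g = T f g" .
  qed (use f in \<open>simp_all add: T_in_L\<close>)
  then show ?thesis using f by (simp add: P.PI_def T_in_L)
qed

lemma T_isometry:
  assumes f: "f1 \<in> IndV" "f2 \<in> IndV"
  shows "L_ip G (T f1) (T f2) = Ind_ip G K ip f1 f2"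
proof -
  have "L_ip G (T f1) (T f2)
      = 1 / of_nat (card K) * (\<Sum>g\<in>carrier G. \<Sum>k\<in>K. T f1 (g \<otimes> k) * cnj (T f2 (g \<otimes> k)))"
    unfolding L_ip_def by (rule sum_average_right)
  also have "(\<Sum>g\<in>carrier G. \<Sum>k\<in>K. T f1 (g \<otimes> k) * cnj (T f2 (g \<otimes> k)))
      = (\<Sum>g\<in>carrier G. \<Sum>k\<in>K. (c * c) * (ip (f1 g) (\<theta> k v) * ip (\<theta> k v) (f2 g)))"
    using f by (intro sum.cong refl)
      (simp add: T_apply Ind_right \<theta>_ip cnj_c ip_commute[symmetric])
  also have "\<dots> = (\<Sum>g\<in>carrier G. ip (f1 g) (f2 g))"
    using q_nonzero by (simp only: sum_distrib_left[symmetric] orbit_parseval c_square) simp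
  finally show ?thesis by (simp add: Ind_ip_def)
qed

text \<open>The values of \<open>T f\<close> on gK are \<open>c\<close> times the frame coefficients
  of f(g), and the frame reconstructs f(g) from them.\<close>

lemma inj_T: "inj_on T IndV"
proof (rule inj_onI)
  fix f1 f2 assume f: "f1 \<in> IndV" "f2 \<in> IndV" and eq: "T f1 = T f2"
  show "f1 = f2"
  proof
    fix g
    show "f1 g = f2 g"
    proof (cases "g \<in> carrier G")
      case True
      have *: "ip (f1 g) (\<theta> k v) = ip (f2 g) (\<theta> k v)" if "k \<in> K" for k
        using fun_cong[OF eq, of "g \<otimes> k"] f True that c_nonzero
        by (simp add: T_apply Ind_right \<theta>_ip)
      have "scale q (f1 g) = scale q (f2 g)"
        unfolding orbit_frame[symmetric] by (simp add: * cong: sum.cong)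
      then show ?thesis using q_nonzero by simp
    qed (use f in \<open>simp add: Ind_outside\<close>)
  qed
qed

lemma T_surj:
  assumes p: "p \<in> P.PI"
  shows "p \<in> T ` IndV"
proof
  \<comment> \<open>Frame synthesis from the values of p on gK; the factor 1/(q c) removes the frame
    bound and the constant of T. This gives T f = p * \<psi> for any p, and equals p because p lies
    in \<open>P.PI\<close>.\<close>
  define f where "f = on_dom (carrier G)
    (\<lambda>g. scale (1 / (q * c)) (\<Sum>k\<in>K. scale (p (g \<otimes> k)) (\<theta> k v)))"
  have f: "f g = scale (1 / (q * c)) (\<Sum>k\<in>K. scale (p (g \<otimes> k)) (\<theta> k v))"
    if "g \<in> carrier G" for g
    using that by (simp add: f_def on_dom_def)
  show "f \<in> IndV"
    unfolding Ind_def
  proof (intro CollectI conjI ballI allI impI)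
    fix g l assume g: "g \<in> carrier G" and l: "l \<in> K"
    have "(\<Sum>k\<in>K. scale (p (g \<otimes> k)) (\<theta> (inv l) (\<theta> k v)))
        = (\<Sum>k\<in>K. scale (p (g \<otimes> (l \<otimes> k))) (\<theta> (inv l) (\<theta> (l \<otimes> k) v)))"
      using sum_subgroup_left[OF subgroup_K l] by (rule sym)
    also have "\<dots> = (\<Sum>k\<in>K. scale (p (g \<otimes> l \<otimes> k)) (\<theta> k v))"
      using g l by (simp add: \<theta>_mult \<theta>_inv_left m_assoc K_carrier cong: sum.cong)
    finally show "f (g \<otimes> l) = \<theta> (inv l) (f g)"
      using g l by (simp add: f \<theta>_scale \<theta>_sum K_inv K_carrier)
  qed (simp add: f_def on_dom_def)
  show "p = T f"
  proof (rule L_ext)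
    fix g assume g: "g \<in> carrier G"
    have "T f g = L_conv G p \<psi> g"
      using g c_nonzero by (simp add: T_apply f conv_\<psi> ip_scale_left ip_sum_left)
    then show "p g = T f g" using P.PI_conv_p[OF p] by simp
  qed (use p \<open>f \<in> IndV\<close> in \<open>simp_all add: P.PI_L T_in_L\<close>)
qed

lemma T_image: "T ` IndV = P.PI"
  using T_in_PI T_surj by blast

lemma bij_betw_T: "bij_betw T IndV P.PI"
  by (simp add: bij_betw_def inj_T T_image)

lemma on_dom_T_intertwiner:
  "on_dom IndV T \<in> intertwiners (carrier G) (fun_scale scale) IndV (ltrans G)
    L_scale (L G) (ltrans G)"
  using Fsp.subspace_add[OF subspace_Ind] Fsp.subspace_scale[OF subspace_Ind]
  by (auto simp: intertwiners_def lin_maps_def on_dom_def T_add T_scale T_ltrans T_in_L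
      ltrans_in_Ind)

lemma isomorphic_PI_Ind:
  "isomorphic_reps (carrier G) L_scale P.PI (ltrans G) (fun_scale scale) IndV (ltrans G)"
proof -
  let ?R = "inv_into IndV T"
  have R: "?R p \<in> IndV" "T (?R p) = p" if "p \<in> P.PI" for p
    using that inv_into_into[of p T IndV] f_inv_into_f[of p T IndV] by (simp_all add: T_image)
  have R_T: "?R (T f) = f" if "f \<in> IndV" for f
    using inj_T that by simp
  \<comment> \<open>Each intertwiner condition on the inverse is checked after applying T, where it
    is already known.\<close>
  have R_eq: "?R p = f" if "f \<in> IndV" "T f = p" for p f
    using R_T that by blast
  have "on_dom P.PI ?R \<in> intertwiners (carrier G) L_scale P.PI (ltrans G)
      (fun_scale scale) IndV (ltrans G)"
    using P.Lsp.subspace_add[OF P.subspace_PI] P.Lsp.subspace_scale[OF P.subspace_PI]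
    by (auto simp: intertwiners_def lin_maps_def on_dom_def R P.ltrans_in_PI ltrans_in_Ind
        T_add T_scale T_ltrans Fsp.subspace_add[OF subspace_Ind]
        Fsp.subspace_scale[OF subspace_Ind] intro!: R_eq)
  moreover have "bij_betw (on_dom P.PI ?R) P.PI IndV"
    using bij_betw_inv_into[OF bij_betw_T] by (subst bij_betw_cong) (auto simp: on_dom_def)
  ultimately show ?thesis by (auto simp: isomorphic_reps_def)
qed

end

section \<open>The Hecke algebra\<close>

context induced_rep
begin

text \<open>The \<open>THE\<close> in \<open>adjoint_on\<close> needs a witness. The coefficient of
  the adjoint of A, applied to y, at b i is forced to be <y, A (b i)>.\<close>

lemma adjoint_eq_basis_sum:
  assumes "Vector_Spaces.linear scale scale A"
  shows "adj A = (\<lambda>y. \<Sum>i\<in>{1..d}. scale (ip y (A (b i))) (b i))"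
proof (rule adjoint_on_eq[OF vector_space_axioms subspace_UNIV])
  interpret A: Vector_Spaces.linear scale scale A by fact
  show "(\<lambda>y. \<Sum>i\<in>{1..d}. scale (ip y (A (b i))) (b i)) \<in> lin_maps scale UNIV scale UNIV"
    by (simp add: lin_maps_def ip_add_left ip_scale_left scale_left_distrib sum.distrib
        scale_sum_right)
  fix x y
  have "ip (A x) y = ip (A (\<Sum>i\<in>{1..d}. scale (ip x (b i)) (b i))) y"
    using basis_expansion[of x] by simp
  also have "\<dots> = ip x (\<Sum>i\<in>{1..d}. scale (ip y (A (b i))) (b i))"
    by (simp add: A.sum A.scale ip_sum_left ip_sum_right ip_scale_left ip_scale_right
        ip_commute[symmetric] mult.commute)
  finally show "ip (A x) y = ip x (\<Sum>i\<in>{1..d}. scale (ip y (A (b i))) (b i))" .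
  show "x = 0" if "ip x x = 0"
    using ip_pos[of x] that by auto
qed (rule ip_add_right)

lemma ip_adj:
  assumes A: "Vector_Spaces.linear scale scale A"
  shows "ip x (adj A y) = ip (A x) y"
proof -
  interpret A: Vector_Spaces.linear scale scale A by fact
  have "ip (A x) y = ip (A (\<Sum>i\<in>{1..d}. scale (ip x (b i)) (b i))) y"
    using basis_expansion[of x] by simp
  then show ?thesis
    by (simp add: adjoint_eq_basis_sum[OF A] A.sum A.scale ip_sum_left ip_sum_right ip_scale_left
        ip_scale_right ip_commute[symmetric] mult.commute)
qed

lemma ip_adj_left: "Vector_Spaces.linear scale scale A \<Longrightarrow> ip (adj A x) y = ip x (A y)"
  by (metis ip_adj ip_commute)

lemma linear_adj: "Vector_Spaces.linear scale scale A \<Longrightarrow> Vector_Spaces.linear scale scale (adj A)"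
  by (simp add: adjoint_eq_basis_sum linear_iff_module_hom module_hom_iff module_axioms ip_add_left
      ip_scale_left scale_left_distrib sum.distrib scale_sum_right)

text \<open>The orbit with coefficients <w, \<theta>(k) v> / q reconstructs every w, so
  \<open>trace_on_frame\<close> applies. Through this identity the single vector v, averaged over K,
  yields a full trace.\<close>

lemma trace_orbit:
  assumes A: "Vector_Spaces.linear scale scale A"
  shows "(\<Sum>k\<in>K. ip (A (\<theta> k v)) (\<theta> k v)) = q * trace_on scale UNIV A"
proof -
  have "trace_on scale UNIV A = (\<Sum>k\<in>K. 1 / q * ip (A (\<theta> k v)) (\<theta> k v))"
  proof (rule trace_on_frame[OF subspace_UNIV _ finite_K])
    show "w = (\<Sum>k\<in>K. scale (1 / q * ip w (\<theta> k v)) (\<theta> k v))" for w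
    proof -
      have "w = scale (1 / q) (\<Sum>k\<in>K. scale (ip w (\<theta> k v)) (\<theta> k v))"
        using q_nonzero by (simp add: orbit_frame)
      then show ?thesis by (simp add: scale_sum_right)
    qed
    show "on_dom UNIV (\<lambda>w. 1 / q * ip w (\<theta> k v)) \<in> lin_maps scale UNIV (*) UNIV" for k
      by (auto simp: on_dom_def lin_maps_def ip_add_left ip_scale_left add_divide_distrib)
    show "A \<in> lin_maps scale UNIV scale UNIV"
      using A by (simp add: lin_maps_UNIV_iff)
  qed simp
  then show ?thesis
    using q_nonzero by (simp add: sum_divide_distrib[symmetric])
qed

section \<open>The star algebra of operator valued functions\<close>

lemma HT_linear: "F \<in> HTil \<Longrightarrow> g \<in> carrier G \<Longrightarrow> Vector_Spaces.linear scale scale (F g)"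
  by (simp add: HT_def)

lemma HT_outside: "F \<in> HTil \<Longrightarrow> g \<notin> carrier G \<Longrightarrow> F g = 0"
  by (simp add: HT_def)

lemma HT_apply:
  "F \<in> HTil \<Longrightarrow> g \<in> carrier G \<Longrightarrow> k1 \<in> K \<Longrightarrow> k2 \<in> K
    \<Longrightarrow> F (k1 \<otimes> g \<otimes> k2) u = \<theta> (inv k2) (F g (\<theta> (inv k1) u))"
  by (simp add: HT_def)

lemma HT_right: "F \<in> HTil \<Longrightarrow> g \<in> carrier G \<Longrightarrow> k \<in> K \<Longrightarrow> F (g \<otimes> k) u = \<theta> (inv k) (F g u)"
  using HT_apply[of F g \<one> k u] by (simp add: K_one \<theta>_one)

lemma HT_left: "F \<in> HTil \<Longrightarrow> g \<in> carrier G \<Longrightarrow> k \<in> K \<Longrightarrow> F (inv k \<otimes> g) u = F g (\<theta> k u)"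
  using HT_apply[of F g "inv k" \<one> u] by (simp add: K_one \<theta>_one K_inv K_carrier)

lemma HT_I:
  assumes "\<And>g. g \<notin> carrier G \<Longrightarrow> F g = 0"
    and "\<And>g. g \<in> carrier G \<Longrightarrow> Vector_Spaces.linear scale scale (F g)"
    and "\<And>g k1 k2 u. g \<in> carrier G \<Longrightarrow> k1 \<in> K \<Longrightarrow> k2 \<in> K
      \<Longrightarrow> F (k1 \<otimes> g \<otimes> k2) u = \<theta> (inv k2) (F g (\<theta> (inv k1) u))"
  shows "F \<in> HTil"
  using assms by (auto simp: HT_def fun_eq_iff)

lemma HT_vec_in_Ind: "F \<in> HTil \<Longrightarrow> (\<lambda>g. F g u) \<in> IndV"
  by (auto simp: Ind_def HT_outside HT_right)

sublocale Hsp: complex_vector_space "HT_scale scale :: complex \<Rightarrow> ('g \<Rightarrow> 'v \<Rightarrow> 'v) \<Rightarrow> _"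
  by (intro complex_vector_space.intro vector_space_fun_scale vector_space_axioms)

lemma subspace_HT: "Hsp.subspace HTil"
proof (rule Hsp.subspaceI)
  have lin: "Vector_Spaces.linear scale scale A \<longleftrightarrow>
      (\<forall>x y. A (x + y) = A x + A y) \<and> (\<forall>z x. A (scale z x) = scale z (A x))" for A
    by (auto simp: linear_iff_module_hom module_hom_iff module_axioms)
  show "0 \<in> HTil"
    by (rule HT_I) (simp_all add: lin \<theta>_zero K_inv)
  show "F1 + F2 \<in> HTil" if "F1 \<in> HTil" "F2 \<in> HTil" for F1 F2
    using HT_linear[OF that(1)] HT_linear[OF that(2)]
    by (intro HT_I) (simp_all add: lin that HT_outside HT_apply \<theta>_add K_inv scale_right_distrib
        fun_eq_iff)
  show "HT_scale scale z F \<in> HTil" if "F \<in> HTil" for z F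
    using HT_linear[OF that]
    by (intro HT_I) (simp_all add: lin that HT_outside HT_apply \<theta>_scale K_inv
        scale_right_distrib scale_left_commute fun_scale_def fun_eq_iff)
qed

lemma HT_star_apply: "g \<in> carrier G \<Longrightarrow> HT_star G scale ip F g = adj (F (inv g))"
  by (simp add: HT_star_def on_dom_def)

lemma HT_star_in_HT:
  assumes F: "F \<in> HTil"
  shows "HT_star G scale ip F \<in> HTil"
proof (rule HT_I)
  show "g \<notin> carrier G \<Longrightarrow> HT_star G scale ip F g = 0" for g
    by (simp add: HT_star_def on_dom_def)
  show "g \<in> carrier G \<Longrightarrow> Vector_Spaces.linear scale scale (HT_star G scale ip F g)" for g
    by (simp add: HT_star_apply linear_adj HT_linear F)
  fix g k1 k2 u assume g: "g \<in> carrier G" and k: "k1 \<in> K" "k2 \<in> K"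
  show "HT_star G scale ip F (k1 \<otimes> g \<otimes> k2) u
      = \<theta> (inv k2) (HT_star G scale ip F g (\<theta> (inv k1) u))"
  proof (rule ip_ext_right)
    fix x
    have "ip x (HT_star G scale ip F (k1 \<otimes> g \<otimes> k2) u) = ip (F (inv (k1 \<otimes> g \<otimes> k2)) x) u"
      using g k by (simp add: HT_star_apply ip_adj HT_linear[OF F] K_carrier)
    also have "inv (k1 \<otimes> g \<otimes> k2) = inv k2 \<otimes> inv g \<otimes> inv k1"
      using g k by (simp add: inv_mult_group m_assoc K_carrier)
    also have "ip (F \<dots> x) u = ip (F (inv g) (\<theta> k2 x)) (\<theta> (inv k1) u)"
      using g k by (simp add: HT_apply[OF F] K_inv K_carrier \<theta>_ip_inv)
    also have "\<dots> = ip x (\<theta> (inv k2) (HT_star G scale ip F g (\<theta> (inv k1) u)))"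
      using g k by (simp add: HT_star_apply ip_adj HT_linear[OF F] \<theta>_ip_inv)
    finally show "ip x (HT_star G scale ip F (k1 \<otimes> g \<otimes> k2) u)
        = ip x (\<theta> (inv k2) (HT_star G scale ip F g (\<theta> (inv k1) u)))" .
  qed
qed

lemma HT_conv_apply:
  "g \<in> carrier G \<Longrightarrow> HT_conv G F1 F2 g u = (\<Sum>h\<in>carrier G. F1 (inv h \<otimes> g) (F2 h u))"
  by (simp add: HT_conv_def on_dom_def sum_fun_apply)

lemma HT_conv_in_HT:
  assumes F: "F1 \<in> HTil" "F2 \<in> HTil"
  shows "HT_conv G F1 F2 \<in> HTil"
proof (rule HT_I)
  show "g \<notin> carrier G \<Longrightarrow> HT_conv G F1 F2 g = 0" for g
    by (simp add: HT_conv_def on_dom_def)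
  have hom: "F g (x + y) = F g x + F g y" "F g (scale z x) = scale z (F g x)"
    if "F \<in> HTil" "g \<in> carrier G" for F g x y z
    using HT_linear[OF that]
    by (simp_all add: linear_iff_module_hom module_hom.add module_hom.scale)
  show "Vector_Spaces.linear scale scale (HT_conv G F1 F2 g)" if "g \<in> carrier G" for g
    using that by (simp add: linear_iff_module_hom module_hom_iff module_axioms HT_conv_apply
        hom F sum.distrib scale_sum_right)
  fix g k1 k2 u assume g: "g \<in> carrier G" and k: "k1 \<in> K" "k2 \<in> K"
  have "HT_conv G F1 F2 (k1 \<otimes> g \<otimes> k2) u
      = (\<Sum>h\<in>carrier G. F1 (inv h \<otimes> (k1 \<otimes> g \<otimes> k2)) (F2 h u))"
    using g k by (simp add: HT_conv_apply K_carrier)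
  \<comment> \<open>Substituting k1 h for h removes k1 from the argument of F1 and passes it to F2,
    where left covariance absorbs it.\<close>
  also have "\<dots> = (\<Sum>h\<in>carrier G. F1 (inv (k1 \<otimes> h) \<otimes> (k1 \<otimes> g \<otimes> k2)) (F2 (k1 \<otimes> h) u))"
    using sum_carrier_left[OF K_carrier[OF k(1)]] by (rule sym)
  also have "\<dots> = (\<Sum>h\<in>carrier G. \<theta> (inv k2) (F1 (inv h \<otimes> g) (F2 h (\<theta> (inv k1) u))))"
  proof (rule sum.cong)
    fix h assume h: "h \<in> carrier G"
    have "inv (k1 \<otimes> h) \<otimes> (k1 \<otimes> g \<otimes> k2) = inv h \<otimes> g \<otimes> k2"
      using g h k by (simp add: inv_mult_group m_assoc K_carrier inv_mult_cancel)
    moreover have "F2 (k1 \<otimes> h) u = F2 h (\<theta> (inv k1) u)"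
      using HT_left[OF F(2) h K_inv[OF k(1)]] k by (simp add: K_carrier)
    ultimately show "F1 (inv (k1 \<otimes> h) \<otimes> (k1 \<otimes> g \<otimes> k2)) (F2 (k1 \<otimes> h) u)
        = \<theta> (inv k2) (F1 (inv h \<otimes> g) (F2 h (\<theta> (inv k1) u)))"
      using g h k by (simp add: HT_right[OF F(1)])
  qed simp
  also have "\<dots> = \<theta> (inv k2) (HT_conv G F1 F2 g (\<theta> (inv k1) u))"
    using g k by (simp add: HT_conv_apply \<theta>_sum K_inv)
  finally show "HT_conv G F1 F2 (k1 \<otimes> g \<otimes> k2) u
      = \<theta> (inv k2) (HT_conv G F1 F2 g (\<theta> (inv k1) u))" .
qed

section \<open>The map S and its inverse\<close>

lemma S_apply: "Sm F g = of_nat d * ip (F g v) v"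
  by (simp add: Sv_def)

lemma S_eq_T: "Sm F = L_scale (of_nat d / c) (T (\<lambda>g. F g v))"
  using c_nonzero by (simp add: fun_eq_iff S_apply T_apply fun_scale_def)

lemma S_add: "Sm (F1 + F2) = Sm F1 + Sm F2"
  by (simp add: fun_eq_iff S_apply ip_add_left distrib_left)

lemma S_scale: "Sm (HT_scale scale z F) = L_scale z (Sm F)"
  by (simp add: fun_eq_iff S_apply fun_scale_def ip_scale_left)

lemma S_in_PI: "F \<in> HTil \<Longrightarrow> Sm F \<in> P.PI"
  unfolding S_eq_T by (intro P.Lsp.subspace_scale[OF P.subspace_PI] T_in_PI HT_vec_in_Ind)

lemma S_in_L: "F \<in> HTil \<Longrightarrow> Sm F \<in> L G"
  by (intro P.PI_L S_in_PI)

lemma S_star: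
  assumes F: "F \<in> HTil"
  shows "Sm (HT_star G scale ip F) = L_star G (Sm F)"
proof (rule L_ext)
  fix g assume g: "g \<in> carrier G"
  then show "Sm (HT_star G scale ip F) g = L_star G (Sm F) g"
    by (simp add: S_apply HT_star_apply L_star_apply ip_adj_left HT_linear[OF F]
        ip_commute[symmetric])
qed (use F in \<open>simp_all add: S_in_L HT_star_in_HT\<close>)

text \<open>Invariance under \<psi> on the right comes from T. On the left it is the right
  invariance of the image of the adjoint function, carried over by the involution, since \<psi> is
  self-adjoint.\<close>

lemma S_in_PH:
  assumes F: "F \<in> HTil"
  shows "Sm F \<in> P.PH"
proof -
  have "L_conv G (L_star G (Sm F)) \<psi> = L_star G (Sm F)"
    using P.PI_conv_p[OF S_in_PI[OF HT_star_in_HT[OF F]]] by (simp add: S_star F)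
  moreover have "L_conv G \<psi> (Sm F) = L_star G (L_conv G (L_star G (Sm F)) \<psi>)"
    using F by (simp add: L_star_conv \<psi>_star L_star_star S_in_L)
  ultimately have "L_conv G \<psi> (Sm F) = Sm F"
    using F by (simp add: L_star_star S_in_L)
  then show ?thesis
    using F by (simp add: P.PH_iff S_in_L P.PI_conv_p S_in_PI)
qed

lemma T_xi:
  assumes f: "f \<in> IndV" and F: "F \<in> HTil"
  shows "T (xi G F f) = L_conv G (T f) (Sm F)"
proof (rule L_ext)
  fix g assume g: "g \<in> carrier G"
  have "L_conv G (T f) (Sm F) g = (\<Sum>h\<in>carrier G. T f h * Sm F (inv h \<otimes> g))"
    using g by (rule L_conv_apply)
  also have "\<dots> = 1 / of_nat (card K) *
      (\<Sum>h\<in>carrier G. \<Sum>k\<in>K. T f (h \<otimes> k) * Sm F (inv (h \<otimes> k) \<otimes> g))"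
    by (rule sum_average_right)
  also have "(\<Sum>h\<in>carrier G. \<Sum>k\<in>K. T f (h \<otimes> k) * Sm F (inv (h \<otimes> k) \<otimes> g))
      = (\<Sum>h\<in>carrier G. q * (c * of_nat d * ip (F (inv h \<otimes> g) (f h)) v))"
  proof (rule sum.cong)
    fix h assume h: "h \<in> carrier G"
    have "(\<Sum>k\<in>K. T f (h \<otimes> k) * Sm F (inv (h \<otimes> k) \<otimes> g))
        = (\<Sum>k\<in>K. c * of_nat d * (ip (f h) (\<theta> k v) * ip (F (inv h \<otimes> g) (\<theta> k v)) v))"
    proof (rule sum.cong)
      fix k assume k: "k \<in> K"
      have "inv (h \<otimes> k) \<otimes> g = inv k \<otimes> (inv h \<otimes> g)"
        using g h k by (simp add: inv_mult_group m_assoc K_carrier)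
      then show "T f (h \<otimes> k) * Sm F (inv (h \<otimes> k) \<otimes> g)
          = c * of_nat d * (ip (f h) (\<theta> k v) * ip (F (inv h \<otimes> g) (\<theta> k v)) v)"
        using f F g h k by (simp add: T_apply S_apply Ind_right \<theta>_ip HT_left)
    qed simp
    also have "\<dots> = q * (c * of_nat d * ip (F (inv h \<otimes> g) (f h)) v)"
      using F g h by (simp only: sum_distrib_left[symmetric] linear_orbit[OF HT_linear[OF F]]
          m_closed inv_closed) simp
    finally show "(\<Sum>k\<in>K. T f (h \<otimes> k) * Sm F (inv (h \<otimes> k) \<otimes> g)) = \<dots>" .
  qed simp
  \<comment> \<open>Here q d / |K| = 1, which accounts for the factor d in the definition of
    S.\<close>
  also have "1 / of_nat (card K) * \<dots> = T (xi G F f) g"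
    using g card_K d_pos
    by (simp add: T_apply xi_def on_dom_def ip_sum_left sum_distrib_left[symmetric] q_def)
  finally show "T (xi G F f) g = L_conv G (T f) (Sm F) g" by simp
next
  show "T (xi G F f) \<in> L G"
    by (simp add: L_def T_apply xi_def on_dom_def)
qed simp

lemma S_conv:
  assumes F: "F1 \<in> HTil" "F2 \<in> HTil"
  shows "Sm (HT_conv G F1 F2) = L_conv G (Sm F2) (Sm F1)"
proof -
  have "(\<lambda>g. HT_conv G F1 F2 g v) = xi G F1 (\<lambda>h. F2 h v)"
    by (auto simp: fun_eq_iff HT_conv_def xi_def on_dom_def sum_fun_apply)
  then have "Sm (HT_conv G F1 F2) = L_scale (of_nat d / c) (T (xi G F1 (\<lambda>h. F2 h v)))"
    by (simp add: S_eq_T)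
  also have "\<dots> = L_conv G (Sm F2) (Sm F1)"
    unfolding T_xi[OF HT_vec_in_Ind[OF F(2)] F(1)] by (simp add: L_conv_scale_left S_eq_T[of F2])
  finally show ?thesis .
qed

text \<open>Shifting the argument by K on both sides produces all matrix coefficients of F(g) along
  the orbit, so \<open>Sm F\<close> contains the whole operator F(g).\<close>

lemma S_orbit:
  assumes F: "F \<in> HTil" and g: "g \<in> carrier G" and k: "k1 \<in> K" "k2 \<in> K"
  shows "Sm F (inv k1 \<otimes> g \<otimes> k2) = of_nat d * ip (F g (\<theta> k1 v)) (\<theta> k2 v)"
  using assms by (simp add: S_apply HT_apply K_inv K_carrier \<theta>_ip)

text \<open>The operator F(g) is recovered from its orbit coefficients by expanding u and w in the
  frame. Each expansion costs 1/q and S contributes d, whence 1/(d q^2) = d/|K|^2.\<close>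

lemma ip_HT:
  assumes F: "F \<in> HTil" and g: "g \<in> carrier G"
  shows "ip (F g u) w = of_nat d / of_nat (card K) ^ 2 *
    (\<Sum>k1\<in>K. \<Sum>k2\<in>K. Sm F (inv k1 \<otimes> g \<otimes> k2) * ip u (\<theta> k1 v) * ip (\<theta> k2 v) w)"
proof -
  have "(\<Sum>k1\<in>K. \<Sum>k2\<in>K. Sm F (inv k1 \<otimes> g \<otimes> k2) * ip u (\<theta> k1 v) * ip (\<theta> k2 v) w)
      = (\<Sum>k1\<in>K. \<Sum>k2\<in>K. (of_nat d * ip u (\<theta> k1 v)) *
          (ip (F g (\<theta> k1 v)) (\<theta> k2 v) * ip (\<theta> k2 v) w))"
    using F g by (intro sum.cong refl) (simp add: S_orbit)
  also have "\<dots> = (\<Sum>k1\<in>K. (of_nat d * q) * (ip u (\<theta> k1 v) * ip (F g (\<theta> k1 v)) w))"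
    by (simp only: sum_distrib_left[symmetric] orbit_parseval) (simp add: sum_distrib_left mult_ac)
  also have "\<dots> = of_nat d * q * q * ip (F g u) w"
    by (simp only: sum_distrib_left[symmetric] linear_orbit[OF HT_linear[OF F g]]) simp
  finally show ?thesis
    using card_K d_pos by (simp add: q_def power2_eq_square)
qed

lemma inj_S: "inj_on Sm HTil"
proof (rule inj_onI)
  fix F1 F2 assume F: "F1 \<in> HTil" "F2 \<in> HTil" and eq: "Sm F1 = Sm F2"
  show "F1 = F2"
  proof
    fix g
    show "F1 g = F2 g"
    proof (cases "g \<in> carrier G")
      case True
      show ?thesis
        by (rule ext, rule ip_ext_left) (simp only: ip_HT[OF F(1) True] ip_HT[OF F(2) True] eq)
    qed (use F in \<open>simp add: HT_outside\<close>)
  qed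
qed

lemma S_surj:
  assumes f: "f \<in> P.PH"
  shows "f \<in> Sm ` HTil"
proof
  let ?a = "of_nat d / of_nat (card K) ^ 2 :: complex"
  \<comment> \<open>The vector form of \<open>ip_HT\<close> with f in place of \<open>Sm F\<close>,
    which is the only possible preimage.\<close>
  define F where "F = on_dom (carrier G) (\<lambda>g u. scale ?a (\<Sum>k1\<in>K. \<Sum>k2\<in>K.
    scale (f (inv k1 \<otimes> g \<otimes> k2) * ip u (\<theta> k1 v)) (\<theta> k2 v)))"
  have F: "F g u = scale ?a (\<Sum>k1\<in>K. \<Sum>k2\<in>K.
      scale (f (inv k1 \<otimes> g \<otimes> k2) * ip u (\<theta> k1 v)) (\<theta> k2 v))" if "g \<in> carrier G" for g u
    using that by (simp add: F_def on_dom_def)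
  show HT: "F \<in> HTil"
  proof (rule HT_I)
    show "g \<notin> carrier G \<Longrightarrow> F g = 0" for g
      by (simp add: F_def on_dom_def)
    show "Vector_Spaces.linear scale scale (F g)" if "g \<in> carrier G" for g
      using that by (simp add: linear_iff_module_hom module_hom_iff module_axioms F ip_add_left
          ip_scale_left distrib_left scale_left_distrib sum.distrib scale_right_distrib
          scale_sum_right mult_ac)
    fix g x y u assume g: "g \<in> carrier G" and xy: "x \<in> K" "y \<in> K"
    \<comment> \<open>With the summand named, covariance of F is a shift of both summation indices,
      k1 to x^-1 k1 and k2 to y k2.\<close>
    define h where "h k1 k2 = scale (f (inv k1 \<otimes> g \<otimes> k2) * ip (\<theta> (inv x) u) (\<theta> k1 v))
      (\<theta> (inv y) (\<theta> k2 v))" for k1 k2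
    have "F (x \<otimes> g \<otimes> y) u = scale ?a (\<Sum>k1\<in>K. \<Sum>k2\<in>K. h (inv x \<otimes> k1) (y \<otimes> k2))"
    proof -
      have "inv k1 \<otimes> (x \<otimes> g \<otimes> y) \<otimes> k2 = inv (inv x \<otimes> k1) \<otimes> g \<otimes> (y \<otimes> k2)"
        if "k1 \<in> K" "k2 \<in> K" for k1 k2
        using that g xy by (simp add: inv_mult_group m_assoc K_carrier)
      then show ?thesis
        using g xy by (simp add: F h_def \<theta>_mult K_inv K_carrier \<theta>_inv_left \<theta>_unitary cong: sum.cong)
    qed
    also have "\<dots> = scale ?a (\<Sum>k1\<in>K. \<Sum>k2\<in>K. h k1 k2)"
      using xy by (simp only: sum_subgroup_left[OF subgroup_K]
          sum_subgroup_left[OF subgroup_K, where f = "\<lambda>k. \<Sum>k2\<in>K. h k k2"] K_inv)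
    also have "\<dots> = \<theta> (inv y) (F g (\<theta> (inv x) u))"
      using g xy by (simp add: F h_def \<theta>_scale \<theta>_sum K_inv)
    finally show "F (x \<otimes> g \<otimes> y) u = \<theta> (inv y) (F g (\<theta> (inv x) u))" .
  qed
  show "f = Sm F"
  proof (rule L_ext)
    fix g assume g: "g \<in> carrier G"
    \<comment> \<open>Written out, the two convolutions with \<psi> are the double sum defining F at
      u = w = v; the constants agree because 1/q^2 = d times \<open>?a\<close>.\<close>
    have "f g = L_conv G (L_conv G \<psi> f) \<psi> g"
      using f by (simp add: P.PH_iff)
    also have "\<dots> = 1 / q * (\<Sum>k2\<in>K. (1 / q * (\<Sum>k1\<in>K. ip v (\<theta> k1 v) * f (inv k1 \<otimes> (g \<otimes> k2))))
        * ip (\<theta> k2 v) v)"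
      using g by (simp add: conv_\<psi> \<psi>_conv K_carrier cong: sum.cong)
    also have "\<dots> = 1 / q * (1 / q) * (\<Sum>k2\<in>K. \<Sum>k1\<in>K.
        f (inv k1 \<otimes> g \<otimes> k2) * ip v (\<theta> k1 v) * ip (\<theta> k2 v) v)"
      using g by (simp add: sum_distrib_left sum_distrib_right m_assoc K_carrier mult_ac
          cong: sum.cong)
    also have "\<dots> = of_nat d * (?a * (\<Sum>k2\<in>K. \<Sum>k1\<in>K.
        f (inv k1 \<otimes> g \<otimes> k2) * ip v (\<theta> k1 v) * ip (\<theta> k2 v) v))"
      using card_K d_pos by (simp add: q_def power2_eq_square)
    also have "\<dots> = Sm F g"
      using g by (subst sum.swap) (simp add: S_apply F ip_scale_left ip_sum_left)
    finally show "f g = Sm F g" .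
  qed (use f HT in \<open>simp_all add: P.PH_iff S_in_L\<close>)
qed

lemma bij_betw_S: "bij_betw Sm HTil P.PH"
  unfolding bij_betw_def using inj_S S_in_PH S_surj by blast

lemma star_anti_isomorphism_S:
  "star_anti_isomorphism (HT_scale scale) HTil (HT_conv G) (HT_star G scale ip)
    L_scale P.PH (L_conv G) (L_star G) Sm"
  unfolding star_anti_isomorphism_def
proof (intro conjI)
  show "star_algebra (HT_scale scale) HTil (HT_conv G) (HT_star G scale ip)"
    by (rule star_algebra_pullback[OF P.star_algebra_PH Hsp.vector_space_axioms subspace_HT inj_S])
      (simp_all add: S_in_PH HT_conv_in_HT HT_star_in_HT S_add S_scale S_conv S_star)
qed (simp_all add: P.star_algebra_PH bij_betw_S S_add S_scale S_conv S_star)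

text \<open>Two averages over K. The one on the right replaces the functional <_, v> by the full
  inner product, giving <F1(g) v, F2(g) v>; the one on the left replaces the vector v by its orbit,
  giving a trace. The constants cancel as (d q / |K|)^2 = 1, and the remaining d undoes the
  normalization in \<open>End_ip\<close>.\<close>

lemma L_ip_S:
  assumes F: "F1 \<in> HTil" "F2 \<in> HTil"
  shows "L_ip G (Sm F1) (Sm F2) = of_nat d * HT_ip G scale ip F1 F2"
proof -
  let ?K = "of_nat (card K) :: complex" and ?d = "of_nat d :: complex"
  define M where "M g = adj (F2 g) \<circ> F1 g" for g
  have linM: "Vector_Spaces.linear scale scale (M g)" if "g \<in> carrier G" for g
    unfolding M_def
    by (intro Vector_Spaces.linear_compose[of _ scale] linear_adj HT_linear F that)
  have "L_ip G (Sm F1) (Sm F2)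
      = 1 / ?K * (\<Sum>g\<in>carrier G. \<Sum>k\<in>K. Sm F1 (g \<otimes> k) * cnj (Sm F2 (g \<otimes> k)))"
    unfolding L_ip_def by (rule sum_average_right)
  also have "(\<Sum>g\<in>carrier G. \<Sum>k\<in>K. Sm F1 (g \<otimes> k) * cnj (Sm F2 (g \<otimes> k)))
      = (\<Sum>g\<in>carrier G. \<Sum>k\<in>K. (?d * ?d) * (ip (F1 g v) (\<theta> k v) * ip (\<theta> k v) (F2 g v)))"
    using F by (intro sum.cong refl) (simp add: S_apply HT_right \<theta>_ip ip_commute[symmetric])
  also have "\<dots> = (?d * ?d * q) * (\<Sum>g\<in>carrier G. ip (F1 g v) (F2 g v))"
    by (simp only: sum_distrib_left[symmetric] orbit_parseval) (simp add: mult.assoc)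
  also have "(\<Sum>g\<in>carrier G. ip (F1 g v) (F2 g v))
      = 1 / ?K * (\<Sum>g\<in>carrier G. \<Sum>k\<in>K. ip (F1 (inv k \<otimes> g) v) (F2 (inv k \<otimes> g) v))"
    by (rule sum_average_left)
  also have "(\<Sum>g\<in>carrier G. \<Sum>k\<in>K. ip (F1 (inv k \<otimes> g) v) (F2 (inv k \<otimes> g) v))
      = (\<Sum>g\<in>carrier G. \<Sum>k\<in>K. ip (M g (\<theta> k v)) (\<theta> k v))"
    using F by (intro sum.cong refl) (simp add: HT_left M_def ip_adj_left HT_linear)
  also have "\<dots> = q * (\<Sum>g\<in>carrier G. trace_on scale UNIV (M g))"
    by (simp add: trace_orbit linM sum_distrib_left)
  finally show ?thesis
    using card_K d_pos by (simp add: HT_ip_def End_ip_def M_def sum_divide_distrib[symmetric] q_def)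
qed

lemma S_isometric:
  "isometric_on HTil (HT_ip G scale ip) (L_ip G)
    (\<lambda>F. L_scale (1 / complex_of_real (sqrt (real d))) (Sm F))"
  unfolding isometric_on_def
proof (intro ballI)
  fix F1 F2 assume F: "F1 \<in> HTil" "F2 \<in> HTil"
  let ?r = "1 / complex_of_real (sqrt (real d))"
  have "L_ip G (L_scale ?r (Sm F1)) (L_scale ?r (Sm F2)) = ?r * ?r * L_ip G (Sm F1) (Sm F2)"
    by (simp add: L_ip_def fun_scale_def sum_distrib_left sum_divide_distrib)
  also have "?r * ?r = 1 / of_nat d"
    by (simp add: of_real_mult[symmetric] del: of_real_mult)
  finally show "L_ip G (L_scale ?r (Sm F1)) (L_scale ?r (Sm F2)) = HT_ip G scale ip F1 F2"
    using d_pos by (simp add: L_ip_S[OF F])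
qed

text \<open>If \<open>F \<noteq> 0\<close> at a point of \<open>K s K\<close>, then \<open>F s\<close> is a nonzero intertwiner.\<close>

lemma support_PH:
  assumes R: "dcoset_reps G K R" and f: "f \<in> P.PH" and g: "f g \<noteq> 0"
  shows "g \<in> (\<Union>s\<in>supp_reps G K scale \<theta> R. dcoset G K s)"
proof -
  obtain F where F: "F \<in> HTil" "f = Sm F" using S_surj[OF f] by blast
  have gG: "g \<in> carrier G" using f g by (auto simp: P.PH_iff L_def)
  then obtain s where s: "s \<in> R" "g \<in> dcoset G K s"
    using R by (auto simp: dcoset_reps_def)
  then have sG: "s \<in> carrier G" using R by (auto simp: dcoset_reps_def)
  obtain k1 k2 where k: "k1 \<in> K" "k2 \<in> K" "g = k1 \<otimes> s \<otimes> k2"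
    using s(2) by (auto simp: dcoset_def r_coset_def set_mult_def)
  have "F s \<noteq> 0"
  proof
    assume "F s = 0"
    then have "F g v = 0" using k F sG by (simp add: HT_apply \<theta>_zero K_inv)
    then show False using g F by (simp add: S_apply)
  qed
  moreover have "F s \<in> intertwiners (conj_inter G K s) scale UNIV \<theta> scale UNIV (conj_rep G \<theta> s)"
    unfolding intertwiners_def
  proof (intro CollectI conjI ballI)
    show "F s \<in> lin_maps scale UNIV scale UNIV"
      using HT_linear[OF F(1) sG] by (simp add: lin_maps_UNIV_iff)
    fix x u assume "x \<in> conj_inter G K s"
    then obtain k where x: "x \<in> K" and k: "k \<in> K" "x = s \<otimes> k \<otimes> inv s"
      by (auto simp: conj_inter_def l_coset_def r_coset_def m_assoc K_carrier sG)
    have xk: "inv s \<otimes> x \<otimes> s = k"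
      using k sG by (simp add: m_assoc K_carrier inv_mult_cancel)
    \<comment> \<open>The same point of G is written as a left and as a right translate of s;
      evaluating F there in both ways is the intertwining relation.\<close>
    have "inv x \<otimes> s = s \<otimes> inv k"
      using k sG by (simp add: inv_mult_group m_assoc K_carrier)
    then have "F s (\<theta> x u) = F (s \<otimes> inv k) u"
      using HT_left[OF F(1) sG x] by simp
    also have "\<dots> = \<theta> k (F s u)"
      using HT_right[OF F(1) sG K_inv[OF k(1)]] k by (simp add: K_carrier)
    finally show "F s (\<theta> x u) = conj_rep G \<theta> s x (F s u)"
      by (simp add: conj_rep_def xk)
  qed
  ultimately have "s \<in> supp_reps G K scale \<theta> R"
    using s(1) by (auto simp: supp_reps_def)
  then show ?thesis using s(2) by blast
qed

section \<open>The inversion formula and the endomorphisms in terms of \<xi>\<close>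

lemma inv_S: "f \<in> P.PH \<Longrightarrow> inv_into HTil Sm f \<in> HTil \<and> Sm (inv_into HTil Sm f) = f"
  by (simp add: S_surj inv_into_into f_inv_into_f)

lemma ip_inv_S:
  assumes "f \<in> P.PH" "g \<in> carrier G"
  shows "ip (inv_into HTil Sm f g u) w = of_nat d / of_nat (card K) ^ 2 *
    (\<Sum>k1\<in>K. \<Sum>k2\<in>K. f (inv k1 \<otimes> g \<otimes> k2) * cnj (ip (\<theta> k1 v) u) * ip (\<theta> k2 v) w)"
  using ip_HT[of "inv_into HTil Sm f" g u w] inv_S[OF assms(1)] assms(2)
  by (simp add: ip_commute[symmetric])

lemma op_eq_xi:
  assumes "f \<in> P.PH" "f' \<in> P.PI"
  shows "L_conv G f' f = T (xi G (inv_into HTil Sm f) (inv_into IndV T f'))"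
  using assms T_surj[of f'] by (simp add: T_xi inv_S inv_into_into f_inv_into_f)

end

theorem theorem3p9:
  fixes G :: "('g, 'm) monoid_scheme"
    and K S :: "'g set"
    and scale :: "complex \<Rightarrow> 'v::ab_group_add \<Rightarrow> 'v"
    and ip :: "'v \<Rightarrow> 'v \<Rightarrow> complex"
    and \<theta> :: "'g \<Rightarrow> 'v \<Rightarrow> 'v"
    and v :: 'v
    and b :: "nat \<Rightarrow> 'v"
    and d :: nat
    and \<psi> :: "'g \<Rightarrow> complex"
    and T :: "('g \<Rightarrow> 'v) \<Rightarrow> 'g \<Rightarrow> complex"
    and Sm :: "('g \<Rightarrow> 'v \<Rightarrow> 'v) \<Rightarrow> 'g \<Rightarrow> complex"
    and IndV :: "('g \<Rightarrow> 'v) set"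
    and HTil :: "('g \<Rightarrow> 'v \<Rightarrow> 'v) set"
    and I H :: "('g \<Rightarrow> complex) set"
    and conv :: "('g \<Rightarrow> complex) \<Rightarrow> ('g \<Rightarrow> complex) \<Rightarrow> 'g \<Rightarrow> complex"  (infixl \<open>\<star>\<close> 70)
  defines "d \<equiv> vector_space.dim scale UNIV"
    and "\<psi> \<equiv> psi K scale ip \<theta> v"
    and "T \<equiv> Tv K scale ip v"
    and "Sm \<equiv> Sv scale ip v"
    and "IndV \<equiv> Ind G K \<theta>"
    and "HTil \<equiv> HT G K scale \<theta>"
    and "I \<equiv> Tv K scale ip v ` Ind G K \<theta>"
    and "H \<equiv> Hpsi G (psi K scale ip \<theta> v)"
    and "conv \<equiv> L_conv G"
  assumes "group G" and "finite (carrier G)" and "subgroup K G"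
    and "fd_inner_product_space scale ip"
    and "unitary_rep G K scale ip \<theta>" and "irreducible_rep K scale \<theta>"
    and "ip_norm ip v = 1"
    and "\<forall>i\<in>{1..d}. \<forall>j\<in>{1..d}. ip (b i) (b j) = (if i = j then 1 else 0)"
    and "module.span scale (b ` {1..d}) = UNIV"
    and "b 1 = v"
    and "dcoset_reps G K S" and "\<one>\<^bsub>G\<^esub> \<in> S"
  shows
    "(
      (on_dom IndV T \<in> intertwiners (carrier G) (fun_scale scale) IndV (ltrans G)
                           L_scale (L G) (ltrans G)) \<and>
      (isometric_on IndV (Ind_ip G K ip) (L_ip G) T) \<and>
      (module.subspace L_scale I \<and> I \<subseteq> L G \<and> (\<forall>g\<in>carrier G. \<forall>f\<in>I. ltrans G g f \<in> I)) \<and>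
      (isomorphic_reps (carrier G) L_scale I (ltrans G) (fun_scale scale) IndV (ltrans G))) \<and>
     (
      (\<psi> \<star> \<psi> = \<psi>) \<and>
      (L_star G \<psi> = \<psi>) \<and>
      (orthogonal_projection L_scale (L_ip G) (L G) I (\<lambda>f. f \<star> \<psi>)) \<and>
      (I = {f \<star> \<psi> |f. f \<in> L G}) \<and>
      (I = {f \<in> L G. f \<star> \<psi> = f})) \<and>
     (
      (H = {f \<in> L G. f = \<psi> \<star> f \<star> \<psi>}) \<and>
      (star_subalgebra L_scale (L G) (\<star>) (L_star G) H) \<and>
      (H \<subseteq> I) \<and>
      (star_anti_isomorphism (HT_scale scale) HTil (HT_conv G) (HT_star G scale ip)
                               L_scale H (\<star>) (L_star G) Sm) \<and>
      (\<forall>f\<in>H. {g. f g \<noteq> 0} \<subseteq> (\<Union>s\<in>supp_reps G K scale \<theta> S. dcoset G K s)) \<and>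
      (isometric_on HTil (HT_ip G scale ip) (L_ip G)
           (\<lambda>F. L_scale (1 / complex_of_real (sqrt (real d))) (Sm F))) \<and>
      (\<forall>f\<in>IndV. \<forall>F\<in>HTil. T (xi G F f) = T f \<star> Sm F) \<and>
      (\<forall>f\<in>H. \<forall>g\<in>carrier G. \<forall>i\<in>{1..d}. \<forall>j\<in>{1..d}.
           ip (inv_into HTil Sm f g (b i)) (b j) =
             of_nat d / of_nat (card K) ^ 2 *
             (\<Sum>k1\<in>K. \<Sum>k2\<in>K. f (inv\<^bsub>G\<^esub> k1 \<otimes>\<^bsub>G\<^esub> g \<otimes>\<^bsub>G\<^esub> k2) *
                cnj (ip (\<theta> k1 (b 1)) (b i)) * ip (\<theta> k2 (b 1)) (b j)))) \<and>
     (
      (star_anti_isomorphism L_scale H (\<star>) (L_star G)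
           (fun_scale L_scale)
           (intertwiners (carrier G) L_scale I (ltrans G) L_scale I (ltrans G))
           (\<circ>) (adjoint_on L_scale (L_ip G) I)
           (\<lambda>f. on_dom I (\<lambda>f'. f' \<star> f))) \<and>
      (\<forall>f\<in>H. \<forall>f'\<in>L G. (\<forall>u\<in>I. L_ip G f' u = 0) \<longrightarrow> f' \<star> f = 0) \<and>
      (\<forall>f\<in>H. \<forall>f'\<in>I. f' \<star> f = T (xi G (inv_into HTil Sm f) (inv_into IndV T f'))) \<and>
      (\<forall>f1\<in>H. \<forall>f2\<in>H.
           End_ip L_scale (L_ip G) I (on_dom I (\<lambda>f'. f' \<star> f1)) (on_dom I (\<lambda>f'. f' \<star> f2)) =
             of_nat (card (carrier G)) / of_nat (vector_space.dim L_scale I) * L_ip G f1 f2))"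
proof -
  interpret group G by fact
  interpret fd_inner_product_space scale ip by fact
  interpret induced_rep G scale ip K \<theta> v b
    using assms(10-18) unfolding d_def
    by (intro induced_rep.intro induced_rep_axioms.intro) auto
  have I: "I = P.PI"
    by (simp add: I_def T_image)
  have H: "H = P.PH"
    by (simp add: H_def P.Hpsi_eq_PH)
  note defs = d_def \<psi>_def T_def Sm_def IndV_def HTil_def conv_def
  show ?thesis
    \<comment> \<open>The last fact rewrites \<open>b 1\<close> to v, so that the inversion formula
      becomes \<open>ip_inv_S\<close> at u = b i and w = b j; folding \<open>P.op_def\<close>
      exposes the operators of part (4).\<close>
    unfolding I H defs P.op_def[symmetric] assms(19)
  proof (intro conjI)
    show "isometric_on (Ind G K \<theta>) (Ind_ip G K ip) (L_ip G) (Tv K scale ip v)"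
      by (simp add: isometric_on_def T_isometry)
    show "P.PI \<subseteq> L G" "P.PH \<subseteq> P.PI"
      using P.PI_L P.PH_PI by auto
    show "P.PI = {L_conv G f (psi K scale ip \<theta> v) |f. f \<in> L G}"
      by (rule P.PI_eq_range)
    show "P.PI = {f \<in> L G. L_conv G f (psi K scale ip \<theta> v) = f}"
      by (simp add: P.PI_def)
    show "P.PH = {f \<in> L G. f = L_conv G (L_conv G (psi K scale ip \<theta> v) f) (psi K scale ip \<theta> v)}"
      by (auto simp: P.PH_def)
    show "star_subalgebra L_scale (L G) (L_conv G) (L_star G) P.PH"
      by (auto simp: star_subalgebra_def star_algebra_L P.star_algebra_PH P.PH_iff)
    show "\<forall>f\<in>P.PH. {g. f g \<noteq> 0} \<subseteq> (\<Union>s\<in>supp_reps G K scale \<theta> S. dcoset G K s)"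
      using support_PH[OF assms(20)] by blast
  qed (use on_dom_T_intertwiner isomorphic_PI_Ind S_isometric star_anti_isomorphism_S
      P.star_anti_isomorphism_op P.orthogonal_projection_PI P.subspace_PI
      in \<open>auto simp: \<psi>_idem \<psi>_star P.ltrans_in_PI T_xi ip_inv_S P.conv_orthogonal op_eq_xi
        P.End_ip_op\<close>)
qed

end
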